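(* Let $U^*\in (V_{N_g})^N\cap\mathcal M^N$ be such that the local minimizer $[U^*]$ of $E$ is the unique critical point in $B([U^*],\delta_1)$, and assume that $\nabla E$, as an operator from $(V_{N_g})^N$ to $(V_{N_g})^N$, is continuous in $B(U^*,\delta_1)$. For a fixed constant $\delta_2\in(0,\delta_1]$ define $$E_0=\min\{E(\tilde U): [\tilde U]\in\overline{B([U^*],\delta_1)\setminus B([U^*],\delta_2)}\},\qquad E_1=\frac{E_0+E(U^* )}{2}.$$ Let $U(t)\in (V_{N_g})^N$ be the solution of $\frac{\mathrm dU}{\mathrm dt}=-\nabla_G E(U)$, $0<t<\infty$, $U(0)=U_0$, where $U_0\in (V_{N_g})^N\cap\mathcal M^N$. If $E(U_0)\le E_1$ and $$\mathrm{Hess}_G E(U)[D,D]\ge\sigma|||D|||^2\qquad\forall\,[U]\in B([U^*],\delta_3),\ \forall\, D\in\mathcal T_{[U]}\mathcal G^N\cap (V_{N_g})^N$$ for some $\delta_3\in(0,\delta_1]$ and $\sigma>0$, then there exists $\hat T>0$ such that $$|||\nabla_G E(U(t))|||\le e^{-\sigma(t-\hat T)},\qquad E(U(t))-E(U^* )\le\frac1{2\sigma}e^{-2\sigma(t-\hat T)}$$ for all $t\ge\hat T$.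
   Context: Setting. $N\ge 1$; $V_{N_g}\subset H^1(\mathbb R^3)$ is a finite-dimensional space (dimension $N_g$) of real-valued functions. For $N$-tuples $\Psi,\Phi$ of functions, $\langle\Psi^\top\Phi\rangle=((\psi_i,\varphi_j)_{L^2(\mathbb R^3)})_{i,j=1}^N$, $(\Psi,\Phi)=\mathrm{tr}\langle\Psi^\top\Phi\rangle$, $|||\Psi|||=(\Psi,\Psi)^{1/2}$. For $P\in\mathbb R^{N\times N}$, $UP$ is the $N$-tuple with $i$-th entry $\sum_j p_{ji}u_j$. $\mathcal M^N=\{U\in (H^1(\mathbb R^3))^N:\langle U^\top U\rangle=I_N\}$; $\mathcal O^N$ is the group of orthogonal $N\times N$ matrices; $[U]=\{UP:P\in\mathcal O^N\}$ for $U\in\mathcal M^N$; $\mathrm{dist}([U],[\hat U])=\inf_{P\in\mathcal O^N}|||U-\hat UP|||$. Closed neighborhoods: $B(U,\delta)=\{\hat U\in (V_{N_g})^N:|||U-\hat U|||\le\delta\}$ and $B([U],\delta)=\{[\hat U]:\hat U\in (V_{N_g})^N\cap\mathcal M^N,\ \mathrm{dist}([U],[\hat U])\le\delta\}$. Tangent space: $\mathcal T_{[U]}\mathcal G^N=\{W\in (H^1(\mathbb R^3))^N:\langle W^\top U\rangle=0\}$. $\delta_1>0$ is a constant. Energy. $E$ is the Kohn-Sham energy $$E(U)=\sum_{i=1}^N\int_{\mathbb R^3}|\nabla u_i|^2\,dr+\int_{\mathbb R^3}V_{ext}\rho_U\,dr+\frac12\iint\frac{\rho_U(r)\rho_U(r')}{|r-r'|}\,dr\,dr'+\int_{\mathbb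 R^3}\varepsilon_{xc}(\rho_U)\rho_U\,dr,\qquad \rho_U=2\sum_{i=1}^N|u_i|^2,$$ where $V_{ext}$ is the external potential (for full potential calculations $V_{ext}(r)=-\sum_{I=1}^M Z_I/|r-R_I|$). Standing assumptions: $E$ is bounded from below on $\mathcal M^N$; the exchange-correlation term is differentiable, with potential $v_{xc}(\rho)=\delta(\rho\,\varepsilon_{xc}(\rho))/\delta\rho$. $\nabla E(U)\in (V_{N_g})^N$ denotes the gradient of $E$ on $(V_{N_g})^N$ with respect to $(\cdot,\cdot)$, i.e. for every $v\in V_{N_g}$ $$((\nabla E(U))_i,v)_{L^2}=4\Big(\tfrac12(\nabla u_i,\nabla v)_{L^2}+(V_{ext}u_i,v)_{L^2}+\Big(\int\frac{\rho_U(r')}{|\cdot-r'|}dr'\,u_i,v\Big)_{L^2}+(v_{xc}(\rho_U)u_i,v)_{L^2}\Big).$$ One has $E(UP)=E(U)$ for $U\in\mathcal M^N$, $P\in\mathcal O^N$, and $\langle U^\top\nabla E(U)\rangle$ is symmetric. Extended Grassmann gradient and Hessian. For $U\in (V_{N_g})^N$, $\nabla_G E(U)=\nabla E(U)\langle U^\top U\rangle-U\langle U^\top\nabla E(U)\rangle$. For $U\in(V_{N_g})^N\cap\mathcal M^N$ and $V,W\in\mathcal T_{[U]}\mathcal G^N\cap(V_{N_g})^N$, $\mathrm{Hess}_G E(U)[V,W]=\mathrm{tr}\langle V^\top\nabla^2E(U)W\rangle-\mathrm{tr}(\langle V^\top W\rangle\langle U^\top\nabla E(U)\rangle)$, where $\nabla^2E(U)$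 is the derivative of $\nabla E$ at $U$. For $U\in (V_{N_g})^N\cap\mathcal M^N$, $[U]$ is a critical point if $\nabla_G E(U)=0$; $[U^*]$ is a local minimizer if $E(U^* )\le E(U)$ for all $[U]\in B([U^*],r)$, for some $r>0$.
   Formalization: The initial value is additionally assumed to satisfy [U_0] ∈ B([U^*],δ_2) and E(U^* ) ≤ E(U_0); without this U_0 may lie in the basin of another critical point and the estimates fail. *)

theory Defs
  imports "HOL-Analysis.Analysis"
begin

type_synonym R3 = "real^3"

section \<open>The Sobolev space of order one\<close>

text \<open>Elements of \<open>L\<^sup>2\<close> and \<open>H\<^sup>1\<close> are represented by Borel functions (not by classes modulo
  null sets). Weak derivatives are tested against compactly supported \<open>C\<^sup>1\<close> functions, which by
  mollification is the same as testing against compactly supported smooth functions.\<close>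

definition L2_fun :: "(R3 \<Rightarrow> 'b::euclidean_space) \<Rightarrow> bool" where
  "L2_fun f \<longleftrightarrow> f \<in> borel_measurable lborel \<and> integrable lborel (\<lambda>r. (norm (f r))\<^sup>2)"

definition l2_inner :: "(R3 \<Rightarrow> 'b::euclidean_space) \<Rightarrow> (R3 \<Rightarrow> 'b) \<Rightarrow> real" where
  "l2_inner f g = (LINT r|lborel. f r \<bullet> g r)"

definition test_function :: "(R3 \<Rightarrow> real) \<Rightarrow> (R3 \<Rightarrow> R3) \<Rightarrow> bool" where
  "test_function \<phi> D\<phi> \<longleftrightarrow>
     (\<forall>r. GDERIV \<phi> r :> D\<phi> r) \<and> continuous_on UNIV D\<phi> \<and> bounded {r. \<phi> r \<noteq> 0}"

definition is_weak_grad :: "(R3 \<Rightarrow> real) \<Rightarrow> (R3 \<Rightarrow> R3) \<Rightarrow> bool" where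
  "is_weak_grad u g \<longleftrightarrow> L2_fun g \<and>
     (\<forall>\<phi> D\<phi>. test_function \<phi> D\<phi> \<longrightarrow>
        (LINT r|lborel. u r *\<^sub>R D\<phi> r) = - (LINT r|lborel. \<phi> r *\<^sub>R g r))"

definition H1_fun :: "(R3 \<Rightarrow> real) \<Rightarrow> bool" where
  "H1_fun u \<longleftrightarrow> L2_fun u \<and> (\<exists>g. is_weak_grad u g)"

text \<open>The weak gradient is unique up to a null set, so the choice does not affect any integral.\<close>

definition weak_grad :: "(R3 \<Rightarrow> real) \<Rightarrow> R3 \<Rightarrow> R3" where
  "weak_grad u = (SOME g. is_weak_grad u g)"


section \<open>The Kohn-Sham energy on tuples of functions\<close>

definition rho :: "('n::finite \<Rightarrow> R3 \<Rightarrow> real) \<Rightarrow> R3 \<Rightarrow> real" where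
  "rho u r = 2 * (\<Sum>i\<in>UNIV. \<bar>u i r\<bar>\<^sup>2)"

text \<open>\<open>exc\<close> and \<open>vxc\<close> map a density (a function) to a function; the local density approximation is
  the case \<open>exc \<rho> r = e (\<rho> r)\<close>.\<close>

definition xc_energy :: "((R3 \<Rightarrow> real) \<Rightarrow> R3 \<Rightarrow> real) \<Rightarrow> ('n::finite \<Rightarrow> R3 \<Rightarrow> real) \<Rightarrow> real" where
  "xc_energy exc u = (LINT r|lborel. exc (rho u) r * rho u r)"

definition ks_energy ::
  "(R3 \<Rightarrow> real) \<Rightarrow> ((R3 \<Rightarrow> real) \<Rightarrow> R3 \<Rightarrow> real) \<Rightarrow> ('n::finite \<Rightarrow> R3 \<Rightarrow> real) \<Rightarrow> real" where
  "ks_energy Vext exc u =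
     (\<Sum>i\<in>UNIV. LINT r|lborel. (norm (weak_grad (u i) r))\<^sup>2)
     + (LINT r|lborel. Vext r * rho u r)
     + 1 / 2 * (LINT r|lborel. LINT r'|lborel. rho u r * rho u r' / norm (r - r'))
     + xc_energy exc u"

text \<open>The set \<open>M\<^sup>N\<close> of orthonormal \<open>N\<close>-tuples in \<open>H\<^sup>1\<close>, where \<open>N = CARD('n)\<close>.\<close>

definition stiefel_H1 :: "('n::finite \<Rightarrow> R3 \<Rightarrow> real) set" where
  "stiefel_H1 = {u. (\<forall>i. H1_fun (u i)) \<and> (\<chi> i j. l2_inner (u i) (u j)) = (mat 1 :: real^'n^'n)}"

text \<open>Finiteness of the integrals in the energy on \<open>H\<^sup>1\<close>; needed because a divergent Bochner
  integral is \<open>0\<close> by convention. (The Coulomb condition always holds, by Hardy's inequality.)\<close>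

definition energy_integrals_finite ::
  "'n::finite itself \<Rightarrow> (R3 \<Rightarrow> real) \<Rightarrow> ((R3 \<Rightarrow> real) \<Rightarrow> R3 \<Rightarrow> real) \<Rightarrow> bool" where
  "energy_integrals_finite _ Vext exc \<longleftrightarrow>
     (\<forall>f. H1_fun f \<longrightarrow> integrable lborel (\<lambda>r. Vext r * (f r)\<^sup>2)) \<and>
     (\<forall>f g. H1_fun f \<longrightarrow> H1_fun g \<longrightarrow>
        integrable (lborel \<Otimes>\<^sub>M lborel) (\<lambda>(r, r'). (f r)\<^sup>2 * (g r')\<^sup>2 / norm (r - r'))) \<and>
     (\<forall>u :: 'n \<Rightarrow> R3 \<Rightarrow> real. (\<forall>i. H1_fun (u i)) \<longrightarrow>
        integrable lborel (\<lambda>r. exc (rho u) r * rho u r))"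


section \<open>The discretization space\<close>

text \<open>A finite-dimensional subspace of \<open>H\<^sup>1\<close> is given by a Euclidean space \<open>'v\<close> with a linear map
  \<open>\<iota>\<close> into \<open>H\<^sup>1\<close> which is isometric for the \<open>L\<^sup>2\<close> inner product: the subspace is \<open>range \<iota>\<close>, its
  dimension is \<open>DIM('v)\<close>, and (choosing representatives of a basis) every nonzero
  finite-dimensional subspace arises in this way. The space of \<open>N\<close>-tuples is then \<open>'v^'n\<close>, and
  its library inner product and norm are \<open>(\<Psi>, \<Phi>) = tr \<langle>\<Psi>\<^sup>T\<Phi>\<rangle>\<close> and \<open>|||\<Psi>|||\<close>.\<close>

definition H1_subspace :: "('v::euclidean_space \<Rightarrow> R3 \<Rightarrow> real) \<Rightarrow> bool" where
  "H1_subspace \<iota> \<longleftrightarrow>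
     (\<forall>a b x y r. \<iota> (a *\<^sub>R x + b *\<^sub>R y) r = a * \<iota> x r + b * \<iota> y r) \<and>
     (\<forall>x. H1_fun (\<iota> x)) \<and>
     (\<forall>x y. x \<bullet> y = l2_inner (\<iota> x) (\<iota> y))"

definition orbitals :: "('v::euclidean_space \<Rightarrow> R3 \<Rightarrow> real) \<Rightarrow> 'v^'n::finite \<Rightarrow> 'n \<Rightarrow> R3 \<Rightarrow> real" where
  "orbitals \<iota> U = (\<lambda>i. \<iota> (U $ i))"

definition gram :: "'v::euclidean_space^'n::finite \<Rightarrow> 'v^'n \<Rightarrow> real^'n^'n" where
  "gram \<Psi> \<Phi> = (\<chi> i j. \<Psi> $ i \<bullet> \<Phi> $ j)"

definition rmul :: "'v::euclidean_space^'n::finite \<Rightarrow> real^'n^'n \<Rightarrow> 'v^'n" (infixl "\<odot>" 75) where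
  "U \<odot> P = (\<chi> i. \<Sum>j\<in>UNIV. (P $ j $ i) *\<^sub>R (U $ j))"

definition stiefel :: "('v::euclidean_space \<Rightarrow> R3 \<Rightarrow> real) \<Rightarrow> ('v^'n::finite) set" where
  "stiefel \<iota> = {U. orbitals \<iota> U \<in> stiefel_H1}"

definition energy ::
  "('v::euclidean_space \<Rightarrow> R3 \<Rightarrow> real) \<Rightarrow> (R3 \<Rightarrow> real) \<Rightarrow> ((R3 \<Rightarrow> real) \<Rightarrow> R3 \<Rightarrow> real)
     \<Rightarrow> 'v^'n::finite \<Rightarrow> real" where
  "energy \<iota> Vext exc U = ks_energy Vext exc (orbitals \<iota> U)"

text \<open>The exchange-correlation term is differentiable on the space of tuples, with potential
  \<open>v\<^sub>x\<^sub>c(\<rho>) = \<delta>(\<rho> \<epsilon>\<^sub>x\<^sub>c(\<rho>))/\<delta>\<rho>\<close>; the factor \<open>4 \<Sum>\<^sub>i u\<^sub>i w\<^sub>i\<close> is the derivative of \<open>\<rho>\<^sub>U\<close> in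
  direction \<open>W\<close>.\<close>

definition xc_differentiable ::
  "'n::finite itself \<Rightarrow> ('v::euclidean_space \<Rightarrow> R3 \<Rightarrow> real) \<Rightarrow> ((R3 \<Rightarrow> real) \<Rightarrow> R3 \<Rightarrow> real)
     \<Rightarrow> ((R3 \<Rightarrow> real) \<Rightarrow> R3 \<Rightarrow> real) \<Rightarrow> bool" where
  "xc_differentiable _ \<iota> exc vxc \<longleftrightarrow> (\<forall>U :: 'v^'n.
     (\<forall>i v. integrable lborel (\<lambda>r. vxc (rho (orbitals \<iota> U)) r * \<iota> (U $ i) r * \<iota> v r)) \<and>
     ((\<lambda>X. xc_energy exc (orbitals \<iota> X)) has_derivative
        (\<lambda>W. LINT r|lborel. vxc (rho (orbitals \<iota> U)) r * (4 * (\<Sum>i\<in>UNIV. \<iota> (U $ i) r * \<iota> (W $ i) r))))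
       (at U))"

definition grad_E ::
  "('v::euclidean_space \<Rightarrow> R3 \<Rightarrow> real) \<Rightarrow> (R3 \<Rightarrow> real) \<Rightarrow> ((R3 \<Rightarrow> real) \<Rightarrow> R3 \<Rightarrow> real)
     \<Rightarrow> 'v^'n::finite \<Rightarrow> 'v^'n" where
  "grad_E \<iota> Vext vxc U = (THE G. \<forall>i v. (G $ i) \<bullet> v =
     4 * (1 / 2 * l2_inner (weak_grad (\<iota> (U $ i))) (weak_grad (\<iota> v))
          + l2_inner (\<lambda>r. Vext r * \<iota> (U $ i) r) (\<iota> v)
          + l2_inner (\<lambda>r. (LINT r'|lborel. rho (orbitals \<iota> U) r' / norm (r - r')) * \<iota> (U $ i) r) (\<iota> v)
          + l2_inner (\<lambda>r. vxc (rho (orbitals \<iota> U)) r * \<iota> (U $ i) r) (\<iota> v)))"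


section \<open>Grassmann geometry\<close>

text \<open>In this section \<open>\<nabla>E\<close> is passed as the argument \<open>g\<close>.\<close>

definition gclass :: "'v::euclidean_space^'n::finite \<Rightarrow> ('v^'n) set" where
  "gclass U = {U \<odot> P |P. orthogonal_matrix P}"

definition gdist :: "'v::euclidean_space^'n::finite \<Rightarrow> 'v^'n \<Rightarrow> real" where
  "gdist U U' = (INF P\<in>{P. orthogonal_matrix P}. norm (U - U' \<odot> P))"

definition gball ::
  "('v::euclidean_space \<Rightarrow> R3 \<Rightarrow> real) \<Rightarrow> 'v^'n::finite \<Rightarrow> real \<Rightarrow> ('v^'n) set set" where
  "gball \<iota> U \<delta> = {gclass U' |U'. U' \<in> stiefel \<iota> \<and> gdist U U' \<le> \<delta>}"

definition gclosure ::
  "('v::euclidean_space \<Rightarrow> R3 \<Rightarrow> real) \<Rightarrow> ('v^'n::finite) set set \<Rightarrow> ('v^'n) set set" where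
  "gclosure \<iota> A = {gclass U |U. U \<in> stiefel \<iota> \<and>
     (\<forall>\<epsilon>>0. \<exists>U'\<in>stiefel \<iota>. gclass U' \<in> A \<and> gdist U U' < \<epsilon>)}"

definition tangent :: "'v::euclidean_space^'n::finite \<Rightarrow> ('v^'n) set" where
  "tangent U = {W. gram W U = 0}"

definition grad_G :: "('v::euclidean_space^'n::finite \<Rightarrow> 'v^'n) \<Rightarrow> 'v^'n \<Rightarrow> 'v^'n" where
  "grad_G g U = g U \<odot> gram U U - U \<odot> gram U (g U)"

definition hess_G ::
  "('v::euclidean_space^'n::finite \<Rightarrow> 'v^'n) \<Rightarrow> 'v^'n \<Rightarrow> 'v^'n \<Rightarrow> 'v^'n \<Rightarrow> real" where
  "hess_G g U V W = trace (gram V (frechet_derivative g (at U) W)) - trace (gram V W ** gram U (g U))"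

definition critical_point ::
  "('v::euclidean_space \<Rightarrow> R3 \<Rightarrow> real) \<Rightarrow> ('v^'n::finite \<Rightarrow> 'v^'n) \<Rightarrow> 'v^'n \<Rightarrow> bool" where
  "critical_point \<iota> g U \<longleftrightarrow> U \<in> stiefel \<iota> \<and> grad_G g U = 0"

definition local_minimizer ::
  "('v::euclidean_space \<Rightarrow> R3 \<Rightarrow> real) \<Rightarrow> ('v^'n::finite \<Rightarrow> real) \<Rightarrow> 'v^'n \<Rightarrow> bool" where
  "local_minimizer \<iota> E U \<longleftrightarrow> U \<in> stiefel \<iota> \<and>
     (\<exists>r>0. \<forall>U'. gclass U' \<in> gball \<iota> U r \<longrightarrow> E U \<le> E U')"

definition is_minimum :: "real set \<Rightarrow> real \<Rightarrow> bool" where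
  "is_minimum A m \<longleftrightarrow> m \<in> A \<and> (\<forall>a\<in>A. m \<le> a)"

end

theory Submission
  imports Defs
begin

text \<open>
  The energy is differentiable on \<open>V\<^sub>N\<^sub>g\<close>-tuples with gradient \<open>\<nabla>E\<close>, and \<open>\<langle>U\<^sup>T\<nabla>E(U)\<rangle>\<close> is symmetric, so the
  flow preserves \<open>\<langle>U\<^sup>TU\<rangle>\<close> and \<open>dE/dt = -|||\<nabla>\<^sub>GE|||\<^sup>2\<close>. A minimizer of \<open>E\<close> over the \<open>\<delta>\<^sub>1\<close>-ball that lies in
  its interior is critical, hence equals \<open>[U\<^sup>*]\<close>; thus \<open>E(U\<^sup>*)\<close> is the minimum over the ball, and the
  level condition \<open>E(U\<^sub>0) \<le> E\<^sub>1\<close> traps the flow in the \<open>\<delta>\<^sub>2\<close>-ball. There \<open>|||\<nabla>\<^sub>GE|||\<close> is bounded away from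
  zero on \<open>{E \<ge> E(U\<^sup>*) + \<epsilon>}\<close>, so \<open>E(U(t))\<close> tends to \<open>E(U\<^sup>*)\<close> and \<open>[U(t)]\<close> to \<open>[U\<^sup>*]\<close>. Inside the
  \<open>\<delta>\<^sub>3\<close>-ball, \<open>d/dt |||\<nabla>\<^sub>GE|||\<^sup>2 = -2 Hess\<^sub>GE[\<nabla>\<^sub>GE,\<nabla>\<^sub>GE] \<le> -2\<sigma> |||\<nabla>\<^sub>GE|||\<^sup>2\<close>, which gives the first estimate;
  since \<open>E - |||\<nabla>\<^sub>GE|||\<^sup>2/(2\<sigma>)\<close> is then nondecreasing, it gives the second as well.
\<close>

section \<open>Weak gradients\<close>

lemma L2_fun_scaleR_integrable:
  fixes f :: "R3 \<Rightarrow> real" and g :: "R3 \<Rightarrow> 'b::euclidean_space"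
  assumes "L2_fun f" "L2_fun g"
  shows "integrable lborel (\<lambda>r. f r *\<^sub>R g r)"
proof (rule Bochner_Integration.integrable_bound)
  show "integrable lborel (\<lambda>r. (norm (f r))\<^sup>2 + (norm (g r))\<^sup>2)"
    using assms by (simp add: L2_fun_def)
  show "(\<lambda>r. f r *\<^sub>R g r) \<in> borel_measurable lborel"
    using assms by (auto simp: L2_fun_def)
  have "\<bar>a\<bar> * b \<le> a\<^sup>2 + b\<^sup>2" if "0 \<le> b" for a b :: real
  proof -
    have "0 \<le> \<bar>a\<bar> * b" using that by simp
    moreover have "2 * (\<bar>a\<bar> * b) \<le> a\<^sup>2 + b\<^sup>2"
      using sum_squares_bound[of "\<bar>a\<bar>" b] by (simp add: mult.assoc)
    ultimately show ?thesis by linarith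
  qed
  then show "AE r in lborel. norm (f r *\<^sub>R g r) \<le> norm ((norm (f r))\<^sup>2 + (norm (g r))\<^sup>2)"
    by simp
qed

lemma L2_fun_inner_integrable:
  fixes f g :: "R3 \<Rightarrow> 'b::euclidean_space"
  assumes "L2_fun f" "L2_fun g"
  shows "integrable lborel (\<lambda>r. f r \<bullet> g r)"
proof (rule Bochner_Integration.integrable_bound)
  show "integrable lborel (\<lambda>r. norm (f r) *\<^sub>R norm (g r))"
    using assms by (intro L2_fun_scaleR_integrable) (auto simp: L2_fun_def)
  show "(\<lambda>r. f r \<bullet> g r) \<in> borel_measurable lborel"
    using assms by (auto simp: L2_fun_def)
qed (use Cauchy_Schwarz_ineq2 in auto)

lemma L2_fun_lincomb:
  fixes f g :: "R3 \<Rightarrow> 'b::euclidean_space"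
  assumes "L2_fun f" "L2_fun g"
  shows "L2_fun (\<lambda>r. a *\<^sub>R f r + b *\<^sub>R g r)"
proof -
  have m: "f \<in> borel_measurable lborel" "g \<in> borel_measurable lborel"
    using assms by (auto simp: L2_fun_def)
  have "integrable lborel (\<lambda>r. a\<^sup>2 * (f r \<bullet> f r) + 2 * a * b * (f r \<bullet> g r) + b\<^sup>2 * (g r \<bullet> g r))"
    using assms by (intro Bochner_Integration.integrable_add integrable_mult_right L2_fun_inner_integrable)
  moreover have "(norm (a *\<^sub>R f r + b *\<^sub>R g r))\<^sup>2
      = a\<^sup>2 * (f r \<bullet> f r) + 2 * a * b * (f r \<bullet> g r) + b\<^sup>2 * (g r \<bullet> g r)" for r
    unfolding power2_norm_eq_inner
    by (simp add: inner_add_left inner_add_right inner_commute power2_eq_square algebra_simps)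
  ultimately show ?thesis using m by (simp add: L2_fun_def)
qed

lemma L2_fun_diff:
  fixes f g :: "R3 \<Rightarrow> 'b::euclidean_space"
  assumes "L2_fun f" "L2_fun g"
  shows "L2_fun (\<lambda>r. f r - g r)"
  using L2_fun_lincomb[OF assms, of 1 "-1"] by simp

lemma continuous_compact_support_L2_fun:
  fixes f :: "R3 \<Rightarrow> 'b::euclidean_space"
  assumes "continuous_on UNIV f" "\<And>r. norm r > R \<Longrightarrow> f r = 0"
  shows "L2_fun f"
proof -
  have "integrable lborel (\<lambda>r. indicator (cball 0 R) r *\<^sub>R (norm (f r))\<^sup>2)"
    using assms(1)
    by (intro borel_integrable_compact) (auto intro!: continuous_intros intro: continuous_on_subset)
  moreover have "(\<lambda>r. indicator (cball 0 R) r *\<^sub>R (norm (f r))\<^sup>2) = (\<lambda>r. (norm (f r))\<^sup>2)"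
    using assms(2) by (force simp: indicator_def)
  ultimately show ?thesis
    using assms(1) by (simp add: L2_fun_def borel_measurable_continuous_onI)
qed

section \<open>Regularity of test functions\<close>

lemma test_function_continuous:
  assumes "test_function \<phi> D\<phi>"
  shows "continuous_on UNIV \<phi>"
  using assms by (auto simp: test_function_def gderiv_def continuous_on_eq_continuous_at
      intro: has_derivative_continuous)

lemma test_function_L2_fun:
  assumes "test_function \<phi> D\<phi>"
  shows "L2_fun \<phi>" "L2_fun D\<phi>"
proof -
  obtain R where R: "\<And>r. \<phi> r \<noteq> 0 \<Longrightarrow> norm r \<le> R"
    using assms by (auto simp: test_function_def bounded_iff)
  show "L2_fun \<phi>"
    using R by (intro continuous_compact_support_L2_fun[of _ R] test_function_continuous[OF assms]) force
  \<comment> \<open>Only the support of \<open>\<phi>\<close> is bounded by definition. Outside the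
    closed ball \<open>\<phi>\<close> agrees with 0 on an open set, so uniqueness of the derivative
    makes \<open>D\<phi>\<close> vanish there too.\<close>
  have "D\<phi> r = 0" if r: "norm r > R" for r
  proof -
    have "GDERIV \<phi> r :> D\<phi> r" using assms by (simp add: test_function_def)
    then have 1: "(\<phi> has_derivative (\<lambda>h. h \<bullet> D\<phi> r)) (at r)" by (simp add: gderiv_def)
    have "((\<lambda>x. 0) has_derivative (\<lambda>h. h \<bullet> D\<phi> r)) (at r)"
    proof (rule has_derivative_transform_within_open[OF 1])
      show "open (- cball 0 R)" "r \<in> - cball 0 R" using r by auto
      show "\<phi> x = 0" if "x \<in> - cball 0 R" for x using R[of x] that by auto
    qed
    then have "(\<lambda>h. h \<bullet> D\<phi> r) = (\<lambda>h. 0)"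
      by (rule has_derivative_unique) simp
    then show ?thesis by (metis inner_eq_zero_iff)
  qed
  then show "L2_fun D\<phi>"
    using assms by (intro continuous_compact_support_L2_fun[of _ R]) (auto simp: test_function_def)
qed

lemma test_function_mult:
  assumes "test_function f Df" "test_function g Dg"
  shows "test_function (\<lambda>r. f r * g r) (\<lambda>r. f r *\<^sub>R Dg r + g r *\<^sub>R Df r)"
  unfolding test_function_def
proof (intro conjI allI)
  fix r show "GDERIV (\<lambda>r. f r * g r) r :> f r *\<^sub>R Dg r + g r *\<^sub>R Df r"
    using assms by (auto simp: test_function_def intro: GDERIV_mult)
  show "continuous_on UNIV (\<lambda>r. f r *\<^sub>R Dg r + g r *\<^sub>R Df r)"
    using assms test_function_continuous[OF assms(1)] test_function_continuous[OF assms(2)]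
    by (auto simp: test_function_def intro!: continuous_intros)
  show "bounded {r. f r * g r \<noteq> 0}"
    using assms by (auto simp: test_function_def intro: bounded_subset)
qed

section \<open>Functions annihilated by all test functions\<close>

lemma DERIV_max_0_square: "((\<lambda>s::real. (max 0 s)\<^sup>2) has_real_derivative 2 * max 0 s) (at s)"
proof (cases "s = 0")
  case True
  \<comment> \<open>At the kink the difference quotient is bounded by |h|; squaring is what removes
    the corner of the positive part.\<close>
  have "((\<lambda>h::real. (max 0 h)\<^sup>2 / h) \<longlongrightarrow> 0) (at 0)"
  proof (rule Lim_null_comparison)
    show "\<forall>\<^sub>F h::real in at 0. norm ((max 0 h)\<^sup>2 / h) \<le> \<bar>h\<bar>"
      by (rule always_eventually) (auto simp: max_def power2_eq_square)
    show "((\<lambda>h::real. \<bar>h\<bar>) \<longlongrightarrow> 0) (at 0)"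
      by (auto intro!: tendsto_eq_intros)
  qed
  then show ?thesis using True by (simp add: DERIV_def)
next
  case False
  show ?thesis
  proof (cases "s > 0")
    case True
    have "((\<lambda>s::real. s\<^sup>2) has_real_derivative 2 * max 0 s) (at s)"
      using True by (auto intro!: derivative_eq_intros)
    then show ?thesis
      by (rule has_field_derivative_transform_within_open[where S = "{0<..}"]) (use True in auto)
  next
    case neg: False
    have "((\<lambda>s::real. 0) has_real_derivative 2 * max 0 s) (at s)"
      using neg by auto
    then show ?thesis
      by (rule has_field_derivative_transform_within_open[where S = "{..<0}"]) (use neg False in auto)
  qed
qed

text \<open>The squared positive part of the quadratic polynomial \<open>?q\<close> is continuously
  differentiable and vanishes off the ball. Balls are wanted as positivity sets because they
  generate the Borel sets.\<close>

lemma ball_test_function: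
  fixes c :: R3
  assumes "R > 0"
  obtains f Df where "test_function f Df" "\<And>r. 0 \<le> f r" "{r. 0 < f r} = ball c R"
proof
  let ?q = "\<lambda>r. R\<^sup>2 - (r - c) \<bullet> (r - c)"
  let ?f = "\<lambda>r. (max 0 (?q r))\<^sup>2"
  have pos: "0 < ?q r \<longleftrightarrow> r \<in> ball c R" for r
  proof -
    have "0 < ?q r \<longleftrightarrow> (norm (r - c))\<^sup>2 < R\<^sup>2" by (simp add: dot_square_norm)
    also have "\<dots> \<longleftrightarrow> norm (r - c) < R"
      using assms power_mono_iff[of R "norm (r - c)" 2] by (auto simp: not_le[symmetric])
    finally show ?thesis by (simp add: dist_norm norm_minus_commute)
  qed
  have "{r. 0 < ?f r} = {r. 0 < ?q r}" by (auto simp: max_def)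
  then show S: "{r. 0 < ?f r} = ball c R" using pos by auto
  show "test_function ?f (\<lambda>r. (2 * max 0 (?q r)) *\<^sub>R (- 2 *\<^sub>R (r - c)))"
    unfolding test_function_def
  proof (intro conjI allI)
    fix r
    have "GDERIV ?q r :> - 2 *\<^sub>R (r - c)"
      unfolding gderiv_def
      by (auto intro!: derivative_eq_intros simp: inner_commute fun_eq_iff)
    then show "GDERIV ?f r :> (2 * max 0 (?q r)) *\<^sub>R (- 2 *\<^sub>R (r - c))"
      by (rule GDERIV_DERIV_compose) (rule DERIV_max_0_square)
    show "continuous_on UNIV (\<lambda>r. (2 * max 0 (?q r)) *\<^sub>R (- 2 *\<^sub>R (r - c)))"
      by (intro continuous_intros)
    have "{r. ?f r \<noteq> 0} \<subseteq> {r. 0 < ?f r}" by auto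
    then show "bounded {r. ?f r \<noteq> 0}" unfolding S by (rule bounded_subset[OF bounded_ball])
  qed
qed simp

text \<open>The functions \<open>k f / (1 + k f)\<close> are test functions increasing to the indicator of \<open>{f > 0}\<close>.\<close>

lemma test_function_annihilator_set:
  fixes h :: "R3 \<Rightarrow> real"
  assumes h: "L2_fun h"
    and ann: "\<And>\<phi> D\<phi>. test_function \<phi> D\<phi> \<Longrightarrow> (LINT r|lborel. \<phi> r * h r) = 0"
    and f: "test_function f Df" "\<And>r. 0 \<le> f r"
  defines "S \<equiv> {r. 0 < f r}"
  shows "integrable lborel (\<lambda>r. indicator S r * h r)" "(LINT r|lborel. indicator S r * h r) = 0"
proof -
  have contf: "continuous_on UNIV f" using f(1) by (rule test_function_continuous)
  have "open S" unfolding S_def using contf by (intro open_Collect_less) auto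
  have bS: "bounded S" using f(1) by (auto simp: S_def test_function_def intro: bounded_subset)
  have "emeasure lborel S < \<infinity>" using bS by (rule emeasure_bounded_finite)
  moreover have "(\<lambda>r. (norm (indicator S r :: real))\<^sup>2) = indicator S"
    by (auto simp: indicator_def)
  ultimately have "L2_fun (indicator S :: R3 \<Rightarrow> real)"
    using \<open>open S\<close> by (simp add: L2_fun_def)
  from L2_fun_scaleR_integrable[OF this h]
  show I: "integrable lborel (\<lambda>r. indicator S r * h r)" by simp
  define \<phi> where "\<phi> k r = real k * f r / (1 + real k * f r)" for k r
  have den: "1 + real k * f r > 0" for k r using f(2)[of r] by (simp add: add_pos_nonneg)
  have tf: "test_function (\<phi> k) (\<lambda>r. (real k / (1 + real k * f r)\<^sup>2) *\<^sub>R Df r)" for k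
    unfolding test_function_def
  proof (intro conjI allI)
    fix r
    have "((\<lambda>s. real k * s / (1 + real k * s)) has_real_derivative real k / (1 + real k * f r)\<^sup>2) (at (f r))"
      using den[of k r]
      by (auto intro!: derivative_eq_intros simp: power2_eq_square field_simps)
    then show "GDERIV (\<phi> k) r :> (real k / (1 + real k * f r)\<^sup>2) *\<^sub>R Df r"
      unfolding \<phi>_def using f(1)
      by (intro GDERIV_DERIV_compose[where g = "\<lambda>s. real k * s / (1 + real k * s)"])
         (auto simp: test_function_def)
    have "1 + real k * f r \<noteq> 0" for r using den[of k r] by simp
    then show "continuous_on UNIV (\<lambda>r. (real k / (1 + real k * f r)\<^sup>2) *\<^sub>R Df r)"
      using f(1) contf by (auto simp: test_function_def intro!: continuous_intros)
    show "bounded {r. \<phi> k r \<noteq> 0}"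
      using f(1) by (auto simp: \<phi>_def test_function_def intro: bounded_subset)
  qed
  \<comment> \<open>Dominated convergence applies because each \<open>\<phi> k\<close> lies between
    0 and 1 and vanishes off \<open>S\<close>.\<close>
  have "(\<lambda>k. LINT r|lborel. \<phi> k r * h r) \<longlonglongrightarrow> (LINT r|lborel. indicator S r * h r)"
  proof (rule integral_dominated_convergence[where w = "\<lambda>r. \<bar>indicator S r * h r\<bar>"])
    show "integrable lborel (\<lambda>r. \<bar>indicator S r * h r\<bar>)" using I by (rule integrable_abs)
    show "(\<lambda>r. indicator S r * h r) \<in> borel_measurable lborel" using I by auto
    show "(\<lambda>r. \<phi> k r * h r) \<in> borel_measurable lborel" for k
      using test_function_L2_fun(1)[OF tf[of k]] h by (auto simp: L2_fun_def)
    show "AE r in lborel. (\<lambda>k. \<phi> k r * h r) \<longlonglongrightarrow> indicator S r * h r"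
    proof (rule AE_I2, rule tendsto_mult_right)
      fix r
      show "(\<lambda>k. \<phi> k r) \<longlonglongrightarrow> indicator S r"
      proof (cases "f r > 0")
        case True
        have "filterlim (\<lambda>k. 1 + real k * f r) at_top sequentially"
          using True by (intro filterlim_tendsto_add_at_top[OF tendsto_const]
              filterlim_at_top_mult_tendsto_pos[OF tendsto_const _ filterlim_real_sequentially]) 
        then have "(\<lambda>k. 1 - 1 / (1 + real k * f r)) \<longlonglongrightarrow> 1 - 0"
          by (intro tendsto_diff tendsto_const) (rule tendsto_divide_0[OF tendsto_const], rule filterlim_at_top_imp_at_infinity)
        moreover have "\<phi> k r = 1 - 1 / (1 + real k * f r)" for k
          using den[of k r] by (simp add: \<phi>_def field_simps)
        ultimately show ?thesis using True by (simp add: S_def)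
      next
        case False
        then have "f r = 0" using f(2)[of r] by simp
        then show ?thesis by (simp add: \<phi>_def S_def)
      qed
    qed
    show "AE r in lborel. norm (\<phi> k r * h r) \<le> \<bar>indicator S r * h r\<bar>" for k
    proof (rule AE_I2)
      fix r
      have "0 \<le> \<phi> k r" "\<phi> k r \<le> 1" using den[of k r] f(2)[of r] by (auto simp: \<phi>_def)
      moreover have "\<phi> k r = 0" if "r \<notin> S" using that f(2)[of r] by (simp add: \<phi>_def S_def)
      ultimately show "norm (\<phi> k r * h r) \<le> \<bar>indicator S r * h r\<bar>"
        by (cases "r \<in> S") (auto simp: abs_mult intro: mult_left_le_one_le)
    qed
  qed
  moreover have "(LINT r|lborel. \<phi> k r * h r) = 0" for k using ann[OF tf] .
  ultimately show "(LINT r|lborel. indicator S r * h r) = 0"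
    by (simp add: LIMSEQ_const_iff)
qed

text \<open>The positivity sets of nonnegative test functions form a pi-system: a product of two
  test functions yields the intersection. It contains all balls, so it generates the Borel sets. The
  measures with densities the positive and negative parts of \<open>h\<close> agree on it, hence
  everywhere, and sigma-finiteness then identifies the densities almost everywhere.\<close>

lemma test_function_annihilator_AE_zero:
  fixes h :: "R3 \<Rightarrow> real"
  assumes h: "L2_fun h"
    and ann: "\<And>\<phi> D\<phi>. test_function \<phi> D\<phi> \<Longrightarrow> (LINT r|lborel. \<phi> r * h r) = 0"
  shows "AE r in lborel. h r = 0"
proof -
  define \<G> where "\<G> = {{r. 0 < f r} | f. (\<exists>Df. test_function f Df) \<and> (\<forall>r. 0 \<le> f r)}"
  have ball\<G>: "ball c R \<in> \<G>" if "R > 0" for c R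
    using ball_test_function[OF that, of c] unfolding \<G>_def by (smt (verit) mem_Collect_eq)
  have op: "open S" if "S \<in> \<G>" for S
    using that by (auto simp: \<G>_def intro!: open_Collect_less dest: test_function_continuous)
  have Istab: "Int_stable \<G>"
    unfolding Int_stable_def
  proof (intro ballI)
    fix A B assume "A \<in> \<G>" "B \<in> \<G>"
    then obtain f Df g Dg where A: "A = {r. 0 < f r}" "test_function f Df" "\<And>r. 0 \<le> f r"
      and B: "B = {r. 0 < g r}" "test_function g Dg" "\<And>r. 0 \<le> g r"
      unfolding \<G>_def by blast
    have "A \<inter> B = {r. 0 < f r * g r}"
    proof -
      have "0 < f r \<and> 0 < g r \<longleftrightarrow> 0 < f r * g r" for r
        using A(3)[of r] B(3)[of r] by (auto simp: zero_less_mult_iff)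
      then show ?thesis using A(1) B(1) by auto
    qed
    moreover have "\<forall>r. 0 \<le> f r * g r" using A B by simp
    ultimately show "A \<inter> B \<in> \<G>"
      using test_function_mult[OF A(2) B(2)] unfolding \<G>_def mem_Collect_eq
      by (intro exI[of _ "\<lambda>r. f r * g r"] conjI exI)
  qed
  have gen: "sets borel = sigma_sets UNIV \<G>"
  proof (rule antisym)
    have "U \<in> sigma_sets UNIV \<G>" if "open U" for U :: "R3 set"
    proof -
      define \<B> where "\<B> = {ball c R | c R. R > 0 \<and> ball c R \<subseteq> U}"
      \<comment> \<open>A sigma-algebra is closed under countable unions only, so the cover of
        \<open>U\<close> by balls is first thinned to a countable one.\<close>
      obtain \<C> where C: "\<C> \<subseteq> \<B>" "countable \<C>" "\<Union>\<C> = \<Union>\<B>"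
        by (rule Lindelof[of \<B>]) (auto simp: \<B>_def)
      have "\<Union>\<B> = U"
      proof (intro equalityI subsetI)
        fix x assume "x \<in> U"
        then obtain e where "0 < e" "ball x e \<subseteq> U" using \<open>open U\<close> open_contains_ball by blast
        then show "x \<in> \<Union>\<B>" unfolding \<B>_def by (intro UnionI[of "ball x e"]) auto
      qed (auto simp: \<B>_def)
      moreover have "\<Union>\<C> \<in> sigma_sets UNIV \<G>"
        using C by (intro sigma_sets_UNION) (auto simp: \<B>_def intro: ball\<G>)
      ultimately show ?thesis using C by simp
    qed
    then show "sets borel \<subseteq> sigma_sets UNIV \<G>"
      unfolding borel_def by (auto intro!: sigma_sets_mono)
    show "sigma_sets UNIV \<G> \<subseteq> sets borel"
      using op sets.sigma_sets_subset[of \<G> borel] by (auto intro: borel_open)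
  qed
  have hm: "h \<in> borel_measurable borel" using h by (simp add: L2_fun_def)
  define p where "p r = ennreal (max 0 (h r))" for r
  define n where "n r = ennreal (max 0 (- h r))" for r
  have pm: "p \<in> borel_measurable lborel" "n \<in> borel_measurable lborel"
    unfolding p_def n_def using hm by auto
  \<comment> \<open>On \<open>S\<close> the function \<open>h\<close> is integrable, so both parts
    have finite integrals, and these differ by the integral of \<open>h\<close> over
    \<open>S\<close>, which is 0.\<close>
  have S: "emeasure (density lborel p) S = emeasure (density lborel n) S \<and>
      emeasure (density lborel p) S \<noteq> \<infinity>" if S\<G>: "S \<in> \<G>" for S
  proof -
    obtain f Df where f: "S = {r. 0 < f r}" "test_function f Df" "\<And>r. 0 \<le> f r"
      using S\<G> unfolding \<G>_def by auto
    have Sb: "S \<in> sets lborel" using op[OF S\<G>] by auto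
    note I = test_function_annihilator_set[OF h ann f(2,3), folded f(1)]
    have i1: "integrable lborel (\<lambda>r. max 0 (indicator S r * h r))"
      using I(1) by (intro integrable_max) auto
    have i2: "integrable lborel (\<lambda>r. max 0 (- (indicator S r * h r)))"
      using I(1) by (intro integrable_max) auto
    have e1: "emeasure (density lborel p) S = ennreal (LINT r|lborel. max 0 (indicator S r * h r))"
      using pm Sb by (subst nn_integral_eq_integral[OF i1, symmetric])
        (auto simp: emeasure_density p_def indicator_def intro!: nn_integral_cong)
    have e2: "emeasure (density lborel n) S = ennreal (LINT r|lborel. max 0 (- (indicator S r * h r)))"
      using pm Sb by (subst nn_integral_eq_integral[OF i2, symmetric])
        (auto simp: emeasure_density n_def indicator_def intro!: nn_integral_cong)
    have "(LINT r|lborel. max 0 (indicator S r * h r)) - (LINT r|lborel. max 0 (- (indicator S r * h r)))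
        = (LINT r|lborel. max 0 (indicator S r * h r) - max 0 (- (indicator S r * h r)))"
      using i1 i2 by simp
    also have "\<dots> = (LINT r|lborel. indicator S r * h r)"
      by (intro Bochner_Integration.integral_cong) auto
    finally show ?thesis using I(2) e1 e2 by simp
  qed
  \<comment> \<open>The radius \<open>Suc k\<close> is positive for every \<open>k\<close>, so each
    ball of the exhausting sequence belongs to \<open>\<G>\<close>.\<close>
  have "density lborel p = density lborel n"
  proof (rule measure_eqI_generator_eq[OF Istab, where \<Omega> = UNIV and A = "\<lambda>k. ball 0 (real (Suc k))"])
    show "range (\<lambda>k. ball 0 (real (Suc k))) \<subseteq> \<G>" using ball\<G> by auto
    show "(\<Union>k. ball (0::R3) (real (Suc k))) = UNIV"
    proof (intro equalityI subsetI)
      fix x :: R3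
      obtain k where "norm x < real k" using reals_Archimedean2 by blast
      then have "x \<in> ball 0 (real (Suc k))" by simp
      then show "x \<in> (\<Union>k. ball 0 (real (Suc k)))" by blast
    qed simp
    show "emeasure (density lborel p) (ball 0 (real (Suc k))) \<noteq> \<infinity>" for k
      by (rule conjunct2[OF S[OF ball\<G>]]) simp
  qed (use S gen in auto)
  then have "AE r in lborel. p r = n r"
    by (rule sigma_finite_measure.density_unique[OF sigma_finite_lborel pm])
  moreover have "h r = 0" if "p r = n r" for r
    using that by (cases "h r \<ge> 0") (auto simp: p_def n_def max_def split: if_splits)
  ultimately show ?thesis by auto
qed

text \<open>Every component of the difference is square integrable and annihilated by all test
  functions. Since \<open>weak_grad\<close> is an arbitrary choice, this uniqueness is the source of
  its linearity up to null sets.\<close>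

lemma weak_grad_unique:
  assumes "is_weak_grad u g1" "is_weak_grad u g2"
  shows "AE r in lborel. g1 r = g2 r"
proof -
  have L: "L2_fun g1" "L2_fun g2" using assms by (auto simp: is_weak_grad_def)
  have "AE r in lborel. (g1 r - g2 r) \<bullet> b = 0" for b :: R3
  proof (rule test_function_annihilator_AE_zero)
    have D: "L2_fun (\<lambda>r. g1 r - g2 r)" using L by (rule L2_fun_diff)
    show "L2_fun (\<lambda>r. (g1 r - g2 r) \<bullet> b)"
      unfolding L2_fun_def
    proof
      show m: "(\<lambda>r. (g1 r - g2 r) \<bullet> b) \<in> borel_measurable lborel"
        using D by (auto simp: L2_fun_def)
      have i: "integrable lborel (\<lambda>r. (norm b)\<^sup>2 * (norm (g1 r - g2 r))\<^sup>2)"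
        using D by (auto simp: L2_fun_def)
      show "integrable lborel (\<lambda>r. (norm ((g1 r - g2 r) \<bullet> b))\<^sup>2)"
      proof (rule Bochner_Integration.integrable_bound[OF i])
        show "(\<lambda>r. (norm ((g1 r - g2 r) \<bullet> b))\<^sup>2) \<in> borel_measurable lborel" using m by auto
        show "AE r in lborel. norm ((norm ((g1 r - g2 r) \<bullet> b))\<^sup>2) \<le> norm ((norm b)\<^sup>2 * (norm (g1 r - g2 r))\<^sup>2)"
        proof (rule AE_I2)
          fix r
          have "\<bar>(g1 r - g2 r) \<bullet> b\<bar>\<^sup>2 \<le> (norm (g1 r - g2 r) * norm b)\<^sup>2"
            by (intro power_mono Cauchy_Schwarz_ineq2) simp
          then show "norm ((norm ((g1 r - g2 r) \<bullet> b))\<^sup>2) \<le> norm ((norm b)\<^sup>2 * (norm (g1 r - g2 r))\<^sup>2)"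
            by (simp add: power_mult_distrib mult.commute)
        qed
      qed
    qed
    fix \<phi> D\<phi> assume t: "test_function \<phi> D\<phi>"
    note L\<phi> = test_function_L2_fun(1)[OF t]
    have "(LINT r|lborel. \<phi> r *\<^sub>R g1 r) = (LINT r|lborel. \<phi> r *\<^sub>R g2 r)"
    proof -
      have "(LINT r|lborel. u r *\<^sub>R D\<phi> r) = - (LINT r|lborel. \<phi> r *\<^sub>R g1 r)"
        "(LINT r|lborel. u r *\<^sub>R D\<phi> r) = - (LINT r|lborel. \<phi> r *\<^sub>R g2 r)"
        using assms t unfolding is_weak_grad_def by blast+
      then show ?thesis by simp
    qed
    moreover have i: "integrable lborel (\<lambda>r. \<phi> r *\<^sub>R g1 r)" "integrable lborel (\<lambda>r. \<phi> r *\<^sub>R g2 r)"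
      using L L\<phi> by (auto intro: L2_fun_scaleR_integrable)
    ultimately have "(LINT r|lborel. \<phi> r *\<^sub>R g1 r - \<phi> r *\<^sub>R g2 r) \<bullet> b = 0"
      by (simp add: Bochner_Integration.integral_diff)
    then have "(LINT r|lborel. (\<phi> r *\<^sub>R g1 r - \<phi> r *\<^sub>R g2 r) \<bullet> b) = 0"
      using i by (subst integral_inner_left) auto
    then show "(LINT r|lborel. \<phi> r * ((g1 r - g2 r) \<bullet> b)) = 0"
      by (simp add: scaleR_diff_right[symmetric])
  qed
  then have "AE r in lborel. \<forall>b\<in>Basis. (g1 r - g2 r) \<bullet> b = 0"
    by (intro AE_finite_allI) auto
  then show ?thesis
    by eventually_elim (auto simp: inner_diff_left intro: euclidean_eqI)
qed

lemma is_weak_grad_weak_grad: "H1_fun u \<Longrightarrow> is_weak_grad u (weak_grad u)"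
  unfolding H1_fun_def weak_grad_def by (metis someI_ex)

lemma is_weak_grad_lincomb:
  assumes u: "L2_fun u" "is_weak_grad u gu" and v: "L2_fun v" "is_weak_grad v gv"
  shows "is_weak_grad (\<lambda>r. a * u r + b * v r) (\<lambda>r. a *\<^sub>R gu r + b *\<^sub>R gv r)"
  unfolding is_weak_grad_def
proof (intro conjI allI impI)
  have L: "L2_fun gu" "L2_fun gv" using u v by (auto simp: is_weak_grad_def)
  then show "L2_fun (\<lambda>r. a *\<^sub>R gu r + b *\<^sub>R gv r)" by (rule L2_fun_lincomb)
  fix \<phi> D\<phi> assume t: "test_function \<phi> D\<phi>"
  note Lt = test_function_L2_fun[OF t]
  have "(LINT r|lborel. (a * u r + b * v r) *\<^sub>R D\<phi> r)
      = (LINT r|lborel. a *\<^sub>R (u r *\<^sub>R D\<phi> r) + b *\<^sub>R (v r *\<^sub>R D\<phi> r))"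
    by (simp add: scaleR_add_left del: Bochner_Integration.integral_add)
  also have "\<dots> = a *\<^sub>R (LINT r|lborel. u r *\<^sub>R D\<phi> r) + b *\<^sub>R (LINT r|lborel. v r *\<^sub>R D\<phi> r)"
    using u v Lt by (subst Bochner_Integration.integral_add)
      (simp_all add: L2_fun_scaleR_integrable del: scaleR_scaleR)
  also have "\<dots> = - (a *\<^sub>R (LINT r|lborel. \<phi> r *\<^sub>R gu r) + b *\<^sub>R (LINT r|lborel. \<phi> r *\<^sub>R gv r))"
    using u v t by (simp add: is_weak_grad_def)
  also have "\<dots> = - (LINT r|lborel. a *\<^sub>R (\<phi> r *\<^sub>R gu r) + b *\<^sub>R (\<phi> r *\<^sub>R gv r))"
    using L Lt by (subst Bochner_Integration.integral_add)
      (simp_all add: L2_fun_scaleR_integrable del: scaleR_scaleR)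
  also have "\<dots> = - (LINT r|lborel. \<phi> r *\<^sub>R (a *\<^sub>R gu r + b *\<^sub>R gv r))"
    by (simp add: scaleR_add_right mult.commute del: Bochner_Integration.integral_add)
  finally show "(LINT r|lborel. (a * u r + b * v r) *\<^sub>R D\<phi> r)
      = - (LINT r|lborel. \<phi> r *\<^sub>R (a *\<^sub>R gu r + b *\<^sub>R gv r))" .
qed

section \<open>Differentiability and invariance of the energy\<close>

lemma linear_expansion:
  fixes L :: "'v::euclidean_space \<Rightarrow> real"
  assumes "linear L"
  shows "L v = (\<Sum>b\<in>Basis. (v \<bullet> b) * L b)"
proof -
  have "L v = L (\<Sum>b\<in>Basis. (v \<bullet> b) *\<^sub>R b)" by (simp add: euclidean_representation)
  also have "\<dots> = (\<Sum>b\<in>Basis. (v \<bullet> b) * L b)"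
    using assms by (simp add: linear_sum linear_cmul)
  finally show ?thesis .
qed

text \<open>Expanding the linear argument in the orthonormal basis reduces the claim to the product
  rule for finite sums, so \<open>G\<close> has to be differentiated only with its second argument
  fixed. Iteration handles bilinear and quadrilinear forms one slot at a time.\<close>

lemma has_derivative_linear_argument:
  fixes G :: "'a::real_normed_vector \<Rightarrow> 'v::euclidean_space \<Rightarrow> real"
  assumes lin: "\<And>y. linear (G y)" "\<And>h. linear (G' h)"
    and G: "\<And>v. ((\<lambda>y. G y v) has_derivative (\<lambda>h. G' h v)) (at x)"
    and f: "(f has_derivative f') (at x)"
  shows "((\<lambda>y. G y (f y)) has_derivative (\<lambda>h. G' h (f x) + G x (f' h))) (at x)"
proof -
  have "((\<lambda>y. \<Sum>b\<in>Basis. (f y \<bullet> b) * G y b) has_derivative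
      (\<lambda>h. \<Sum>b\<in>Basis. (f x \<bullet> b) * G' h b + (f' h \<bullet> b) * G x b)) (at x)"
    by (intro has_derivative_sum has_derivative_mult G has_derivative_inner_left f)
  moreover have "(\<Sum>b\<in>Basis. (f y \<bullet> b) * G y b) = G y (f y)" for y
    by (rule linear_expansion[OF lin(1), symmetric])
  moreover have "(\<Sum>b\<in>Basis. (f x \<bullet> b) * G' h b + (f' h \<bullet> b) * G x b) = G' h (f x) + G x (f' h)" for h
    unfolding sum.distrib using linear_expansion[OF lin(1)] linear_expansion[OF lin(2)] by metis
  ultimately show ?thesis by simp
qed

lemma linear_has_derivative:
  fixes L :: "'v::euclidean_space \<Rightarrow> real"
  assumes "linear L" "(f has_derivative f') F"
  shows "((\<lambda>y. L (f y)) has_derivative (\<lambda>h. L (f' h))) F"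
  using assms(2) by (rule bounded_linear.has_derivative[OF assms(1)[unfolded linear_conv_bounded_linear]])

lemma bilinear_has_derivative:
  fixes B :: "'v::euclidean_space \<Rightarrow> 'v \<Rightarrow> real"
  assumes B: "bilinear B"
    and d: "(p has_derivative p') (at x)" "(q has_derivative q') (at x)"
  shows "((\<lambda>y. B (p y) (q y)) has_derivative (\<lambda>h. B (p' h) (q x) + B (p x) (q' h))) (at x)"
proof -
  have l: "linear (B x)" "linear (\<lambda>x. B x y)" for x y using B by (auto simp: bilinear_def)
  show ?thesis
    by (rule has_derivative_linear_argument[OF l(1) l(1) linear_has_derivative[OF l(2) d(1)] d(2)])
qed

text \<open>The pattern is that of the Hartree energy: \<open>p\<close> fills the two slots of one
  density, \<open>q\<close> those of the other.\<close>

lemma quadrilinear_has_derivative: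
  fixes M :: "'v::euclidean_space \<Rightarrow> 'v \<Rightarrow> 'v \<Rightarrow> 'v \<Rightarrow> real"
  assumes l1: "\<And>b c d. linear (\<lambda>a. M a b c d)" and l2: "\<And>a c d. linear (\<lambda>b. M a b c d)"
    and l3: "\<And>a b d. linear (\<lambda>c. M a b c d)" and l4: "\<And>a b c. linear (M a b c)"
    and p: "(p has_derivative p') (at x)" and q: "(q has_derivative q') (at x)"
  shows "((\<lambda>y. M (p y) (p y) (q y) (q y)) has_derivative
      (\<lambda>h. M (p' h) (p x) (q x) (q x) + M (p x) (p' h) (q x) (q x)
         + M (p x) (p x) (q' h) (q x) + M (p x) (p x) (q x) (q' h))) (at x)"
proof -
  have 1: "((\<lambda>y. M (p y) b c d) has_derivative (\<lambda>h. M (p' h) b c d)) (at x)" for b c d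
    by (rule linear_has_derivative[OF l1 p])
  have 2: "((\<lambda>y. M (p y) (p y) c d) has_derivative
      (\<lambda>h. M (p' h) (p x) c d + M (p x) (p' h) c d)) (at x)" for c d
    by (rule has_derivative_linear_argument[OF l2 l2 1 p])
  have 3: "((\<lambda>y. M (p y) (p y) (q y) d) has_derivative
      (\<lambda>h. (M (p' h) (p x) (q x) d + M (p x) (p' h) (q x) d) + M (p x) (p x) (q' h) d)) (at x)" for d
    by (rule has_derivative_linear_argument[OF l3 linear_compose_add[OF l3 l3] 2 q])
  show ?thesis
    by (rule has_derivative_linear_argument[OF l4
          linear_compose_add[OF linear_compose_add[OF l4 l4] l4] 3 q])
qed

lemma bilinearI:
  assumes "\<And>x y z. B (x + y) z = B x z + B y z" "\<And>c x z. B (c *\<^sub>R x) z = c *\<^sub>R B x z"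
    "\<And>x y z. B z (x + y) = B z x + B z y" "\<And>c x z. B z (c *\<^sub>R x) = c *\<^sub>R B z x"
  shows "bilinear B"
  unfolding bilinear_def by (intro conjI allI linearI) (simp_all add: assms)

section \<open>Orthogonal mixing of the components of a tuple\<close>

lemma orthogonal_matrix_entries:
  fixes P :: "real^'n^'n"
  assumes "orthogonal_matrix P"
  shows "(\<Sum>i\<in>UNIV. P $ j $ i * P $ k $ i) = (if j = k then 1 else 0)"
proof -
  have "P ** transpose P = mat 1" using assms by (simp add: orthogonal_matrix_def)
  then have "(P ** transpose P) $ j $ k = (if j = k then 1 else 0)" by (simp add: mat_def)
  then show ?thesis by (simp add: matrix_matrix_mult_def transpose_def)
qed

text \<open>After expansion in both slots the coefficient of \<open>B (U $ j) (U $ k)\<close> is an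
  entry of \<open>P ** transpose P\<close>, so only the diagonal survives. Applied to pointwise
  products, the kinetic form and the inner product, it gives invariance of the density, the kinetic
  energy and the norm.\<close>

lemma bilinear_rmul_invariant:
  fixes B :: "'v::euclidean_space \<Rightarrow> 'v \<Rightarrow> real"
  assumes B: "bilinear B" and P: "orthogonal_matrix P"
  shows "(\<Sum>i\<in>UNIV. B ((U \<odot> P) $ i) ((U \<odot> P) $ i)) = (\<Sum>i\<in>UNIV. B (U $ i) (U $ i))"
proof -
  have "B ((U \<odot> P) $ i) ((U \<odot> P) $ i)
      = (\<Sum>j\<in>UNIV. \<Sum>k\<in>UNIV. P $ j $ i * P $ k $ i * B (U $ j) (U $ k))" for i
  proof -
    have l: "linear (B x)" "linear (\<lambda>x. B x y)" for x y using B by (auto simp: bilinear_def)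
    show ?thesis
      by (simp add: rmul_def linear_sum[OF l(1)] linear_cmul[OF l(1)] linear_sum[OF l(2)]
          linear_cmul[OF l(2)] sum_distrib_left mult.assoc)
         (subst sum.swap, simp add: mult.left_commute)
  qed
  then have "(\<Sum>i\<in>UNIV. B ((U \<odot> P) $ i) ((U \<odot> P) $ i))
      = (\<Sum>i\<in>UNIV. \<Sum>j\<in>UNIV. \<Sum>k\<in>UNIV. P $ j $ i * P $ k $ i * B (U $ j) (U $ k))" by simp
  also have "\<dots> = (\<Sum>j\<in>UNIV. \<Sum>i\<in>UNIV. \<Sum>k\<in>UNIV. P $ j $ i * P $ k $ i * B (U $ j) (U $ k))"
    by (rule sum.swap)
  also have "\<dots> = (\<Sum>j\<in>UNIV. \<Sum>k\<in>UNIV. \<Sum>i\<in>UNIV. P $ j $ i * P $ k $ i * B (U $ j) (U $ k))"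
    by (intro sum.cong refl sum.swap)
  also have "\<dots> = (\<Sum>j\<in>UNIV. \<Sum>k\<in>UNIV. (if j = k then 1 else 0) * B (U $ j) (U $ k))"
    by (simp only: sum_distrib_right[symmetric] orthogonal_matrix_entries[OF P])
  also have "\<dots> = (\<Sum>j\<in>UNIV. B (U $ j) (U $ j))"
    by (intro sum.cong refl) (simp add: if_distrib[of "\<lambda>c. c * _"] cong: if_cong)
  finally show ?thesis .
qed

text \<open>The parameter \<open>ty\<close> fixes the number of orbitals, which the types of the
  other parameters do not determine.\<close>

locale kohn_sham =
  fixes \<iota> :: "'v::euclidean_space \<Rightarrow> R3 \<Rightarrow> real"
    and Vext :: "R3 \<Rightarrow> real"
    and exc vxc :: "(R3 \<Rightarrow> real) \<Rightarrow> R3 \<Rightarrow> real"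
    and ty :: "'n::finite itself"
  assumes space: "H1_subspace \<iota>"
    and finite_energy: "energy_integrals_finite ty Vext exc"
    and xc: "xc_differentiable ty \<iota> exc vxc"
begin

lemma iota_add: "\<iota> (x + y) r = \<iota> x r + \<iota> y r"
  using space unfolding H1_subspace_def by (metis mult_1 scaleR_one)

lemma iota_scaleR: "\<iota> (c *\<^sub>R x) r = c * \<iota> x r"
proof -
  have "\<iota> (c *\<^sub>R x + 0 *\<^sub>R x) r = c * \<iota> x r + 0 * \<iota> x r"
    using space unfolding H1_subspace_def by blast
  then show ?thesis by simp
qed

lemma iota_lincomb: "\<iota> (a *\<^sub>R x + b *\<^sub>R y) r = a * \<iota> x r + b * \<iota> y r"
  by (simp add: iota_add iota_scaleR)

lemma iota_sum: "\<iota> (\<Sum>i\<in>I. f i) r = (\<Sum>i\<in>I. \<iota> (f i) r)"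
proof -
  have "linear (\<lambda>x. \<iota> x r)" by (intro linearI) (simp_all add: iota_add iota_scaleR)
  then show ?thesis by (rule linear_sum)
qed

lemma iota_H1: "H1_fun (\<iota> x)"
  using space by (simp add: H1_subspace_def)

lemma iota_inner: "x \<bullet> y = l2_inner (\<iota> x) (\<iota> y)"
  using space by (simp add: H1_subspace_def)

lemma iota_L2: "L2_fun (\<iota> x)"
  using iota_H1[of x] by (simp add: H1_fun_def)

section \<open>Kinetic, external and Hartree forms\<close>

definition kin :: "'v \<Rightarrow> 'v \<Rightarrow> real" where
  "kin x y = l2_inner (weak_grad (\<iota> x)) (weak_grad (\<iota> y))"

definition ext :: "'v \<Rightarrow> 'v \<Rightarrow> real" where
  "ext x y = (LINT r|lborel. Vext r * (\<iota> x r * \<iota> y r))"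

text \<open>Four independent arguments on the product space make the Coulomb energy a quadrilinear
  form to which Fubini applies directly.\<close>

definition hartree_density :: "'v \<Rightarrow> 'v \<Rightarrow> 'v \<Rightarrow> 'v \<Rightarrow> R3 \<times> R3 \<Rightarrow> real" where
  "hartree_density a b c d z =
     \<iota> a (fst z) * \<iota> b (fst z) * (\<iota> c (snd z) * \<iota> d (snd z)) / norm (fst z - snd z)"

definition hartree :: "'v \<Rightarrow> 'v \<Rightarrow> 'v \<Rightarrow> 'v \<Rightarrow> real" where
  "hartree a b c d = integral\<^sup>L (lborel \<Otimes>\<^sub>M lborel) (hartree_density a b c d)"

text \<open>The identity holds almost everywhere only, because \<open>weak_grad\<close> chooses a
  representative for each function separately.\<close>

lemma weak_grad_iota_lincomb:
  "AE r in lborel. weak_grad (\<iota> (a *\<^sub>R x + b *\<^sub>R y)) r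
     = a *\<^sub>R weak_grad (\<iota> x) r + b *\<^sub>R weak_grad (\<iota> y) r"
proof (rule weak_grad_unique)
  show "is_weak_grad (\<iota> (a *\<^sub>R x + b *\<^sub>R y)) (weak_grad (\<iota> (a *\<^sub>R x + b *\<^sub>R y)))"
    by (intro is_weak_grad_weak_grad iota_H1)
  have "is_weak_grad (\<lambda>r. a * \<iota> x r + b * \<iota> y r)
      (\<lambda>r. a *\<^sub>R weak_grad (\<iota> x) r + b *\<^sub>R weak_grad (\<iota> y) r)"
    by (intro is_weak_grad_lincomb is_weak_grad_weak_grad iota_H1 iota_L2)
  then show "is_weak_grad (\<iota> (a *\<^sub>R x + b *\<^sub>R y))
      (\<lambda>r. a *\<^sub>R weak_grad (\<iota> x) r + b *\<^sub>R weak_grad (\<iota> y) r)"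
    by (simp add: iota_lincomb[abs_def])
qed

lemma L2_weak_grad_iota: "L2_fun (weak_grad (\<iota> x))"
  using is_weak_grad_weak_grad[OF iota_H1[of x]] by (simp add: is_weak_grad_def)

lemma kin_commute: "kin x y = kin y x"
  by (simp add: kin_def l2_inner_def inner_commute)

lemma kin_lincomb: "kin (a *\<^sub>R x + b *\<^sub>R y) z = a * kin x z + b * kin y z"
proof -
  have m: "weak_grad (\<iota> w) \<in> borel_measurable borel" for w
    using L2_weak_grad_iota[of w] by (simp add: L2_fun_def)
  have i: "integrable lborel (\<lambda>r. weak_grad (\<iota> w) r \<bullet> weak_grad (\<iota> z) r)" for w
    by (intro L2_fun_inner_integrable L2_weak_grad_iota)
  have "kin (a *\<^sub>R x + b *\<^sub>R y) z = (LINT r|lborel. a * (weak_grad (\<iota> x) r \<bullet> weak_grad (\<iota> z) r)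
      + b * (weak_grad (\<iota> y) r \<bullet> weak_grad (\<iota> z) r))"
    unfolding kin_def l2_inner_def
  proof (rule integral_cong_AE)
    show "AE r in lborel. weak_grad (\<iota> (a *\<^sub>R x + b *\<^sub>R y)) r \<bullet> weak_grad (\<iota> z) r
        = a * (weak_grad (\<iota> x) r \<bullet> weak_grad (\<iota> z) r) + b * (weak_grad (\<iota> y) r \<bullet> weak_grad (\<iota> z) r)"
      using weak_grad_iota_lincomb[of a x b y]
      by eventually_elim (simp add: inner_add_left)
  qed (use m in auto)
  also have "\<dots> = a * kin x z + b * kin y z"
    using i by (simp add: kin_def l2_inner_def)
  finally show ?thesis .
qed

lemma kin_bilinear: "bilinear kin"
proof -
  have 1: "kin (x + y) z = kin x z + kin y z" for x y z using kin_lincomb[of 1 x 1 y z] by simp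
  have 2: "kin (c *\<^sub>R x) z = c * kin x z" for c x z using kin_lincomb[of c x 0 x z] by simp
  show ?thesis
    by (rule bilinearI) (simp_all add: 1 2 kin_commute[of _ "_ + _"] kin_commute[of _ "_ *\<^sub>R _"],
        simp_all add: kin_commute)
qed

text \<open>Finiteness is given for squares; polarization with \<open>x + y\<close>,
  \<open>x\<close> and \<open>y\<close> passes to mixed products.\<close>

lemma ext_integrable: "integrable lborel (\<lambda>r. Vext r * (\<iota> x r * \<iota> y r))"
proof -
  have "integrable lborel (\<lambda>r. Vext r * (\<iota> w r)\<^sup>2)" for w
    using finite_energy iota_H1 by (simp add: energy_integrals_finite_def)
  then have "integrable lborel (\<lambda>r. (Vext r * (\<iota> (x + y) r)\<^sup>2 - Vext r * (\<iota> x r)\<^sup>2 - Vext r * (\<iota> y r)\<^sup>2) / 2)"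
    by (intro Bochner_Integration.integrable_diff integrable_divide_zero)
  moreover have "(Vext r * (\<iota> (x + y) r)\<^sup>2 - Vext r * (\<iota> x r)\<^sup>2 - Vext r * (\<iota> y r)\<^sup>2) / 2
      = Vext r * (\<iota> x r * \<iota> y r)" for r
    by (simp add: iota_add power2_eq_square algebra_simps)
  ultimately show ?thesis by simp
qed

lemma ext_bilinear: "bilinear ext"
proof (rule bilinearI)
  show "ext (x + y) z = ext x z + ext y z" for x y z
    using Bochner_Integration.integral_add[OF ext_integrable[of x z] ext_integrable[of y z]]
    by (simp add: ext_def iota_add algebra_simps)
  show "ext z (x + y) = ext z x + ext z y" for x y z
    using Bochner_Integration.integral_add[OF ext_integrable[of z x] ext_integrable[of z y]]
    by (simp add: ext_def iota_add algebra_simps)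
  show "ext (c *\<^sub>R x) z = c *\<^sub>R ext x z" "ext z (c *\<^sub>R x) = c *\<^sub>R ext z x" for c x z
    by (simp_all add: ext_def iota_scaleR mult.left_commute[of _ c] mult.assoc)
qed

text \<open>Polarization in both variables: each of the two products is a quarter of a difference of
  squares, hence four signed terms and the divisor 16.\<close>

lemma hartree_integrable: "integrable (lborel \<Otimes>\<^sub>M lborel) (hartree_density a b c d)"
proof -
  define Q where "Q x y z = (\<iota> x (fst z))\<^sup>2 * (\<iota> y (snd z))\<^sup>2 / norm (fst z - snd z)" for x y and z :: "R3 \<times> R3"
  have Q: "integrable (lborel \<Otimes>\<^sub>M lborel) (Q x y)" for x y
    using finite_energy iota_H1[of x] iota_H1[of y]
    by (simp add: energy_integrals_finite_def Q_def[abs_def] case_prod_beta')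
  have "integrable (lborel \<Otimes>\<^sub>M lborel) (\<lambda>z. (Q (a + b) (c + d) z - Q (a - b) (c + d) z
      - Q (a + b) (c - d) z + Q (a - b) (c - d) z) / 16)"
    by (intro Bochner_Integration.integrable_diff Bochner_Integration.integrable_add
        integrable_divide_zero Q)
  moreover have "(Q (a + b) (c + d) z - Q (a - b) (c + d) z
      - Q (a + b) (c - d) z + Q (a - b) (c - d) z) / 16 = hartree_density a b c d z" for z
  proof -
    have m: "\<iota> (x - y) r = \<iota> x r - \<iota> y r" for x y r
      using iota_lincomb[of 1 x "-1" y r] by simp
    have "(Q (a + b) (c + d) z - Q (a - b) (c + d) z - Q (a + b) (c - d) z + Q (a - b) (c - d) z)
      = ((\<iota> a (fst z) + \<iota> b (fst z))\<^sup>2 - (\<iota> a (fst z) - \<iota> b (fst z))\<^sup>2)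
        * ((\<iota> c (snd z) + \<iota> d (snd z))\<^sup>2 - (\<iota> c (snd z) - \<iota> d (snd z))\<^sup>2) / norm (fst z - snd z)"
      by (simp add: Q_def m iota_add left_diff_distrib right_diff_distrib diff_divide_distrib)
    also have "\<dots> = (4 * (\<iota> a (fst z) * \<iota> b (fst z))) * (4 * (\<iota> c (snd z) * \<iota> d (snd z))) / norm (fst z - snd z)"
      by (simp add: power2_sum power2_diff)
    finally show ?thesis by (simp add: hartree_density_def)
  qed
  ultimately show ?thesis by simp
qed

lemma hartree_linear:
  "linear (\<lambda>a. hartree a b c d)" "linear (\<lambda>b. hartree a b c d)"
  "linear (\<lambda>c. hartree a b c d)" "linear (hartree a b c)"
proof -
  have add: "hartree_density (x + y) b c d z = hartree_density x b c d z + hartree_density y b c d z"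
    "hartree_density a (x + y) c d z = hartree_density a x c d z + hartree_density a y c d z"
    "hartree_density a b (x + y) d z = hartree_density a b x d z + hartree_density a b y d z"
    "hartree_density a b c (x + y) z = hartree_density a b c x z + hartree_density a b c y z"
    for a b c d x y z
    by (simp_all add: hartree_density_def iota_add add_divide_distrib algebra_simps)
  have scale: "hartree_density (s *\<^sub>R a) b c d z = s * hartree_density a b c d z"
    "hartree_density a (s *\<^sub>R b) c d z = s * hartree_density a b c d z"
    "hartree_density a b (s *\<^sub>R c) d z = s * hartree_density a b c d z"
    "hartree_density a b c (s *\<^sub>R d) z = s * hartree_density a b c d z"
    for a b c d s z
    by (simp_all add: hartree_density_def iota_scaleR)
  show "linear (\<lambda>a. hartree a b c d)" "linear (\<lambda>b. hartree a b c d)"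
    "linear (\<lambda>c. hartree a b c d)" "linear (hartree a b c)"
    by (intro linearI; simp add: hartree_def add[abs_def] scale[abs_def] hartree_integrable)+
qed

lemma hartree_commute: "hartree a b c d = hartree b a c d" "hartree a b c d = hartree a b d c"
  by (simp_all add: hartree_def hartree_density_def[abs_def] mult.commute)

text \<open>The Coulomb kernel is symmetric, so exchanging the integration variables exchanges the
  two densities.\<close>

lemma hartree_swap: "hartree a b c d = hartree c d a b"
proof -
  have "hartree a b c d = integral\<^sup>L (lborel \<Otimes>\<^sub>M lborel) (\<lambda>(x, y). hartree_density a b c d (y, x))"
    unfolding hartree_def
    by (intro lborel_pair.integral_product_swap[symmetric] borel_measurable_integrable hartree_integrable)
  also have "(\<lambda>(x, y). hartree_density a b c d (y, x)) = hartree_density c d a b"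
    by (simp add: fun_eq_iff hartree_density_def norm_minus_commute mult.commute)
  finally show ?thesis by (simp add: hartree_def)
qed

lemma rho_orbitals: "rho (orbitals \<iota> U) r = 2 * (\<Sum>i\<in>UNIV. (\<iota> (U $ i) r)\<^sup>2)"
  by (simp add: rho_def orbitals_def)

text \<open>Four times the weak form of the Kohn-Sham Hamiltonian with its potentials frozen at
  \<open>U\<close>. Keeping \<open>x\<close> independent of \<open>U\<close> exposes the symmetry in
  \<open>x\<close> and \<open>v\<close> and the dependence on \<open>U\<close> through the density
  alone.\<close>

definition ham :: "'v^'n \<Rightarrow> 'v \<Rightarrow> 'v \<Rightarrow> real" where
  "ham U x v = 4 * (1 / 2 * kin x v + ext x v + (\<Sum>j\<in>UNIV. 2 * hartree x v (U $ j) (U $ j))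
     + (LINT r|lborel. vxc (rho (orbitals \<iota> U)) r * (\<iota> x r * \<iota> v r)))"

lemma vxc_integrable:
  fixes U :: "'v^'n"
  shows "integrable lborel (\<lambda>r. vxc (rho (orbitals \<iota> U)) r * (\<iota> (U $ i) r * \<iota> v r))"
  using xc by (simp add: xc_differentiable_def mult.assoc)

lemma ham_commute: "ham U x y = ham U y x"
proof -
  have "ext x y = ext y x" by (simp add: ext_def mult.commute)
  moreover have "(LINT r|lborel. vxc (rho (orbitals \<iota> U)) r * (\<iota> x r * \<iota> y r))
      = (LINT r|lborel. vxc (rho (orbitals \<iota> U)) r * (\<iota> y r * \<iota> x r))"
    by (simp add: mult.commute)
  moreover have "(\<Sum>j\<in>UNIV. 2 * hartree x y (U $ j) (U $ j)) = (\<Sum>j\<in>UNIV. 2 * hartree y x (U $ j) (U $ j))"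
    by (intro sum.cong refl arg_cong[where f = "\<lambda>x. 2 * x"] hartree_commute(1))
  ultimately show ?thesis by (simp add: ham_def kin_commute[of x y])
qed

text \<open>The exchange-correlation integrals are known to converge only if one factor is an
  orbital of \<open>U\<close>. Linearity is therefore stated for combinations of orbitals here, and
  for a first argument \<open>U $ i\<close> in \<open>ham_linear\<close>.\<close>

lemma ham_sum:
  fixes U :: "'v^'n"
  shows "ham U (\<Sum>j\<in>UNIV. a j *\<^sub>R U $ j) v = (\<Sum>j\<in>UNIV. a j * ham U (U $ j) v)"
proof -
  have l: "linear (\<lambda>x. kin x v)" "linear (\<lambda>x. ext x v)" "linear (\<lambda>x. hartree x v c d)" for c d
    using kin_bilinear ext_bilinear hartree_linear by (auto simp: bilinear_def)
  have *: "L (\<Sum>j\<in>UNIV. a j *\<^sub>R U $ j) = (\<Sum>j\<in>UNIV. a j * L (U $ j))" if "linear L" for L :: "'v \<Rightarrow> real"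
    by (simp add: linear_sum[OF that] linear_cmul[OF that])
  let ?p = "\<lambda>r. vxc (rho (orbitals \<iota> U)) r"
  have "(LINT r|lborel. ?p r * (\<iota> (\<Sum>j\<in>UNIV. a j *\<^sub>R U $ j) r * \<iota> v r))
      = (LINT r|lborel. (\<Sum>j\<in>UNIV. a j * (?p r * (\<iota> (U $ j) r * \<iota> v r))))"
    by (simp add: iota_sum iota_scaleR sum_distrib_left sum_distrib_right ac_simps)
  also have "\<dots> = (\<Sum>j\<in>UNIV. LINT r|lborel. a j * (?p r * (\<iota> (U $ j) r * \<iota> v r)))"
    by (intro Bochner_Integration.integral_sum integrable_mult_right vxc_integrable)
  also have "\<dots> = (\<Sum>j\<in>UNIV. a j * (LINT r|lborel. ?p r * (\<iota> (U $ j) r * \<iota> v r)))"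
    by simp
  finally have v: "(LINT r|lborel. ?p r * (\<iota> (\<Sum>j\<in>UNIV. a j *\<^sub>R U $ j) r * \<iota> v r))
      = (\<Sum>j\<in>UNIV. a j * (LINT r|lborel. ?p r * (\<iota> (U $ j) r * \<iota> v r)))" .
  have h: "(\<Sum>k\<in>UNIV. 2 * (\<Sum>j\<in>UNIV. a j * hartree (U $ j) v (U $ k) (U $ k)))
      = (\<Sum>j\<in>UNIV. a j * (\<Sum>k\<in>UNIV. 2 * hartree (U $ j) v (U $ k) (U $ k)))"
    unfolding sum_distrib_left by (subst sum.swap) (simp add: mult.left_commute)
  show ?thesis
    unfolding ham_def v *[OF l(1)] *[OF l(2)] *[OF l(3)] h
    by (simp add: distrib_left sum.distrib sum_distrib_left mult.left_commute)
qed

lemma ham_linear: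
  fixes U :: "'v^'n"
  shows "linear (ham U (U $ i))"
proof (rule linearI)
  have l: "linear (kin x)" "linear (ext x)" "linear (\<lambda>y. hartree x y c d)" for x c d
    using kin_bilinear ext_bilinear hartree_linear by (auto simp: bilinear_def)
  show "ham U (U $ i) (x + y) = ham U (U $ i) x + ham U (U $ i) y" for x y
  proof -
    have "(LINT r|lborel. vxc (rho (orbitals \<iota> U)) r * (\<iota> (U $ i) r * \<iota> (x + y) r))
        = (LINT r|lborel. vxc (rho (orbitals \<iota> U)) r * (\<iota> (U $ i) r * \<iota> x r)
          + vxc (rho (orbitals \<iota> U)) r * (\<iota> (U $ i) r * \<iota> y r))"
      by (simp add: iota_add distrib_left)
    also have "\<dots> = (LINT r|lborel. vxc (rho (orbitals \<iota> U)) r * (\<iota> (U $ i) r * \<iota> x r))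
          + (LINT r|lborel. vxc (rho (orbitals \<iota> U)) r * (\<iota> (U $ i) r * \<iota> y r))"
      by (intro Bochner_Integration.integral_add vxc_integrable)
    finally show ?thesis
      by (simp add: ham_def linear_add[OF l(1)] linear_add[OF l(2)] linear_add[OF l(3)]
          sum.distrib algebra_simps)
  qed
  show "ham U (U $ i) (c *\<^sub>R x) = c *\<^sub>R ham U (U $ i) x" for c x
  proof -
    have "(LINT r|lborel. vxc (rho (orbitals \<iota> U)) r * (\<iota> (U $ i) r * \<iota> (c *\<^sub>R x) r))
        = (LINT r|lborel. c * (vxc (rho (orbitals \<iota> U)) r * (\<iota> (U $ i) r * \<iota> x r)))"
      by (simp add: iota_scaleR ac_simps)
    then show ?thesis
      by (simp add: ham_def linear_cmul[OF l(1)] linear_cmul[OF l(2)] linear_cmul[OF l(3)]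
          sum_distrib_left algebra_simps)
  qed
qed

section \<open>The gradient as a Riesz representative\<close>

lemma hartree_density_rho:
  "(\<iota> x (fst z) * \<iota> y (fst z)) * rho (orbitals \<iota> U) (snd z) / norm (fst z - snd z)
     = (\<Sum>j\<in>UNIV. 2 * hartree_density x y (U $ j) (U $ j) z)"
  by (simp add: rho_orbitals hartree_density_def sum_distrib_left sum_divide_distrib power2_eq_square ac_simps)

text \<open>Fubini for the integrable \<open>hartree_density\<close> turns the nested integral in
  \<open>grad_E\<close> into the quadrilinear form.\<close>

lemma hartree_potential:
  fixes U :: "'v^'n"
  shows "l2_inner (\<lambda>r. (LINT r'|lborel. rho (orbitals \<iota> U) r' / norm (r - r')) * \<iota> x r) (\<iota> v)
    = (\<Sum>j\<in>UNIV. 2 * hartree x v (U $ j) (U $ j))"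
proof -
  have "((LINT r'|lborel. rho (orbitals \<iota> U) r' / norm (r - r')) * \<iota> x r) * \<iota> v r
      = (LINT r'|lborel. (\<Sum>j\<in>UNIV. 2 * hartree_density x v (U $ j) (U $ j) (r, r')))" for r
  proof -
    have "((LINT r'|lborel. rho (orbitals \<iota> U) r' / norm (r - r')) * \<iota> x r) * \<iota> v r
        = (\<iota> x r * \<iota> v r) * (LINT r'|lborel. rho (orbitals \<iota> U) r' / norm (r - r'))" by simp
    \<comment> \<open>The rule covers a divergent inner integral too: both sides are then 0 by
      convention.\<close>
    also have "\<dots> = (LINT r'|lborel. (\<iota> x r * \<iota> v r) * (rho (orbitals \<iota> U) r' / norm (r - r')))"
      by (rule integral_mult_right_zero[symmetric])
    also have "\<dots> = (LINT r'|lborel. (\<Sum>j\<in>UNIV. 2 * hartree_density x v (U $ j) (U $ j) (r, r')))"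
      using hartree_density_rho[of x "(r, _)" v U] by simp
    finally show ?thesis .
  qed
  then have "l2_inner (\<lambda>r. (LINT r'|lborel. rho (orbitals \<iota> U) r' / norm (r - r')) * \<iota> x r) (\<iota> v)
      = (LINT r|lborel. LINT r'|lborel. (\<Sum>j\<in>UNIV. 2 * hartree_density x v (U $ j) (U $ j) (r, r')))"
    by (simp add: l2_inner_def)
  also have "\<dots> = integral\<^sup>L (lborel \<Otimes>\<^sub>M lborel) (\<lambda>z. \<Sum>j\<in>UNIV. 2 * hartree_density x v (U $ j) (U $ j) z)"
    by (rule lborel_pair.integral_fst')
       (intro Bochner_Integration.integrable_sum integrable_mult_right hartree_integrable)
  also have "\<dots> = (\<Sum>j\<in>UNIV. 2 * hartree x v (U $ j) (U $ j))"
    unfolding hartree_def by (simp add: hartree_integrable)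
  finally show ?thesis .
qed

text \<open>The right side is linear in \<open>v\<close>, so in the Euclidean space
  \<open>'v\<close> it has exactly one representing vector for each \<open>i\<close>. Existence and
  uniqueness justify the definite description in \<open>grad_E\<close>.\<close>

lemma grad_E_inner:
  fixes U :: "'v^'n"
  shows "grad_E \<iota> Vext vxc U $ i \<bullet> v = ham U (U $ i) v"
proof -
  have h: "4 * (1 / 2 * l2_inner (weak_grad (\<iota> (U $ i))) (weak_grad (\<iota> v))
          + l2_inner (\<lambda>r. Vext r * \<iota> (U $ i) r) (\<iota> v)
          + l2_inner (\<lambda>r. (LINT r'|lborel. rho (orbitals \<iota> U) r' / norm (r - r')) * \<iota> (U $ i) r) (\<iota> v)
          + l2_inner (\<lambda>r. vxc (rho (orbitals \<iota> U)) r * \<iota> (U $ i) r) (\<iota> v)) = ham U (U $ i) v" for i v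
    unfolding hartree_potential ham_def kin_def ext_def by (simp add: l2_inner_def mult.assoc)
  let ?P = "\<lambda>G :: 'v^'n. \<forall>i v. (G $ i) \<bullet> v = ham U (U $ i) v"
  have "?P (grad_E \<iota> Vext vxc U)"
    unfolding grad_E_def h
  proof (rule theI)
    show P: "?P (\<chi> i. \<Sum>b\<in>Basis. ham U (U $ i) b *\<^sub>R b)"
    proof (intro allI)
      fix i v
      have "(\<Sum>b\<in>Basis. ham U (U $ i) b *\<^sub>R b) \<bullet> v = (\<Sum>b\<in>Basis. (v \<bullet> b) * ham U (U $ i) b)"
        unfolding inner_sum_left by (intro sum.cong refl) (simp add: inner_commute)
      also have "\<dots> = ham U (U $ i) v" by (rule linear_expansion[OF ham_linear, symmetric])
      finally show "(\<chi> i. \<Sum>b\<in>Basis. ham U (U $ i) b *\<^sub>R b) $ i \<bullet> v = ham U (U $ i) v" by simp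
    qed
    fix G assume G: "?P G"
    show "G = (\<chi> i. \<Sum>b\<in>Basis. ham U (U $ i) b *\<^sub>R b)"
    proof (subst vec_eq_iff, rule allI)
      fix i
      have "\<forall>z. G $ i \<bullet> z = (\<chi> i. \<Sum>b\<in>Basis. ham U (U $ i) b *\<^sub>R b) $ i \<bullet> z"
        using G[rule_format, of i] P[rule_format, of i] by simp
      then show "G $ i = (\<chi> i. \<Sum>b\<in>Basis. ham U (U $ i) b *\<^sub>R b) $ i"
        by (rule vector_eq_rdot[THEN iffD1])
    qed
  qed
  then show ?thesis by blast
qed

text \<open>The entries are values of \<open>ham U\<close> on pairs of orbitals, and that form is
  symmetric.\<close>

lemma gram_grad_E_symmetric:
  fixes U :: "'v^'n"
  shows "transpose (gram U (grad_E \<iota> Vext vxc U)) = gram U (grad_E \<iota> Vext vxc U)"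
  by (simp add: gram_def transpose_def vec_eq_iff inner_commute[of "U $ _"] grad_E_inner ham_commute)

section \<open>Rotation invariance of density and energy, equivariance of the gradient\<close>

lemma rho_rmul:
  fixes U :: "'v^'n"
  assumes "orthogonal_matrix P"
  shows "rho (orbitals \<iota> (U \<odot> P)) = rho (orbitals \<iota> U)"
proof
  fix r
  have "bilinear (\<lambda>x y. \<iota> x r * \<iota> y r)"
    by (rule bilinearI) (simp_all add: iota_add iota_scaleR algebra_simps)
  from bilinear_rmul_invariant[OF this assms, of U]
  show "rho (orbitals \<iota> (U \<odot> P)) r = rho (orbitals \<iota> U) r"
    by (simp add: rho_orbitals power2_eq_square)
qed

lemma kinetic_energy: "(\<Sum>i\<in>UNIV. LINT r|lborel. (norm (weak_grad (orbitals \<iota> U i) r))\<^sup>2) = (\<Sum>i\<in>UNIV. kin (U $ i) (U $ i))"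
  by (simp add: kin_def l2_inner_def orbitals_def power2_norm_eq_inner)

lemma energy_rmul:
  fixes U :: "'v^'n"
  assumes "orthogonal_matrix P"
  shows "energy \<iota> Vext exc (U \<odot> P) = energy \<iota> Vext exc U"
  unfolding energy_def ks_energy_def xc_energy_def kinetic_energy rho_rmul[OF assms]
    bilinear_rmul_invariant[OF kin_bilinear assms] ..

text \<open>The form \<open>ham U\<close> sees \<open>U\<close> only through its density, which
  mixing leaves alone; the gradient then transforms linearly with the orbitals.\<close>

lemma grad_E_rmul:
  fixes U :: "'v^'n"
  assumes P: "orthogonal_matrix P"
  shows "grad_E \<iota> Vext vxc (U \<odot> P) = grad_E \<iota> Vext vxc U \<odot> P"
proof -
  \<comment> \<open>Reading the sum back as an integral against the density makes its invariance
    apparent.\<close>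
  have hart: "(\<Sum>j\<in>UNIV. 2 * hartree x v ((U \<odot> P) $ j) ((U \<odot> P) $ j))
      = (\<Sum>j\<in>UNIV. 2 * hartree x v (U $ j) (U $ j))" for x v
    by (simp flip: hartree_potential add: rho_rmul[OF P])
  have ham: "ham (U \<odot> P) x v = ham U x v" for x v
    by (simp only: ham_def rho_rmul[OF P] hart)
  have "grad_E \<iota> Vext vxc (U \<odot> P) $ i \<bullet> v = (grad_E \<iota> Vext vxc U \<odot> P) $ i \<bullet> v" for i v
  proof -
    have "grad_E \<iota> Vext vxc (U \<odot> P) $ i \<bullet> v = ham U ((U \<odot> P) $ i) v"
      by (simp add: grad_E_inner ham)
    also have "\<dots> = (\<Sum>j\<in>UNIV. P $ j $ i * ham U (U $ j) v)"
      by (simp add: rmul_def ham_sum)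
    also have "\<dots> = (grad_E \<iota> Vext vxc U \<odot> P) $ i \<bullet> v"
      by (simp add: rmul_def inner_sum_left grad_E_inner)
    finally show ?thesis .
  qed
  then have "grad_E \<iota> Vext vxc (U \<odot> P) $ i = (grad_E \<iota> Vext vxc U \<odot> P) $ i" for i
    using vector_eq_rdot by blast
  then show ?thesis by (simp add: vec_eq_iff)
qed

section \<open>Polynomial form of the energy and its derivative\<close>

lemma external_energy:
  fixes U :: "'v^'n"
  shows "(LINT r|lborel. Vext r * rho (orbitals \<iota> U) r) = (\<Sum>i\<in>UNIV. 2 * ext (U $ i) (U $ i))"
proof -
  have "(LINT r|lborel. Vext r * rho (orbitals \<iota> U) r)
      = (LINT r|lborel. (\<Sum>i\<in>UNIV. 2 * (Vext r * (\<iota> (U $ i) r * \<iota> (U $ i) r))))"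
    by (simp add: rho_orbitals sum_distrib_left power2_eq_square ac_simps)
  also have "\<dots> = (\<Sum>i\<in>UNIV. LINT r|lborel. 2 * (Vext r * (\<iota> (U $ i) r * \<iota> (U $ i) r)))"
    by (intro Bochner_Integration.integral_sum integrable_mult_right ext_integrable)
  finally show ?thesis by (simp add: ext_def)
qed

lemma hartree_energy:
  fixes U :: "'v^'n"
  shows "(LINT r|lborel. LINT r'|lborel. rho (orbitals \<iota> U) r * rho (orbitals \<iota> U) r' / norm (r - r'))
    = (\<Sum>i\<in>UNIV. \<Sum>j\<in>UNIV. 4 * hartree (U $ i) (U $ i) (U $ j) (U $ j))"
proof -
  have "rho (orbitals \<iota> U) r * rho (orbitals \<iota> U) r' / norm (r - r')
      = (\<Sum>i\<in>UNIV. \<Sum>j\<in>UNIV. 4 * hartree_density (U $ i) (U $ i) (U $ j) (U $ j) (r, r'))" for r r'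
    by (simp add: rho_orbitals hartree_density_def sum_distrib_left sum_distrib_right sum_divide_distrib
        power2_eq_square ac_simps)
  then have "(LINT r|lborel. LINT r'|lborel. rho (orbitals \<iota> U) r * rho (orbitals \<iota> U) r' / norm (r - r'))
    = (LINT r|lborel. LINT r'|lborel. (\<Sum>i\<in>UNIV. \<Sum>j\<in>UNIV. 4 * hartree_density (U $ i) (U $ i) (U $ j) (U $ j) (r, r')))"
    by simp
  also have "\<dots> = integral\<^sup>L (lborel \<Otimes>\<^sub>M lborel)
      (\<lambda>z. \<Sum>i\<in>UNIV. \<Sum>j\<in>UNIV. 4 * hartree_density (U $ i) (U $ i) (U $ j) (U $ j) z)"
    by (rule lborel_pair.integral_fst')
       (intro Bochner_Integration.integrable_sum integrable_mult_right hartree_integrable)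
  also have "\<dots> = (\<Sum>i\<in>UNIV. \<Sum>j\<in>UNIV. 4 * hartree (U $ i) (U $ i) (U $ j) (U $ j))"
    unfolding hartree_def by (simp add: hartree_integrable)
  finally show ?thesis .
qed

text \<open>Apart from the exchange-correlation term the energy is a polynomial built from
  \<open>kin\<close>, \<open>ext\<close> and \<open>hartree\<close>. Their symmetries collapse the
  slotwise derivatives, and the resulting coefficients 2, 4, 8 and 4 are those of
  \<open>ham\<close>.\<close>

lemma energy_has_derivative:
  fixes U :: "'v^'n"
  shows "(energy \<iota> Vext exc has_derivative (\<lambda>W. grad_E \<iota> Vext vxc U \<bullet> W)) (at U)"
proof -
  have comp: "((\<lambda>X :: 'v^'n. X $ i) has_derivative (\<lambda>W. W $ i)) (at U)" for i
    by (rule bounded_linear_imp_has_derivative) (rule bounded_linear_vec_nth)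
  have kin: "((\<lambda>X. \<Sum>i\<in>UNIV. kin (X $ i) (X $ i)) has_derivative
      (\<lambda>W. \<Sum>i\<in>UNIV. kin (W $ i) (U $ i) + kin (U $ i) (W $ i))) (at U)"
    by (rule has_derivative_sum) (rule bilinear_has_derivative[OF kin_bilinear comp comp])
  have ext: "((\<lambda>X. \<Sum>i\<in>UNIV. 2 * ext (X $ i) (X $ i)) has_derivative
      (\<lambda>W. \<Sum>i\<in>UNIV. 2 * (ext (W $ i) (U $ i) + ext (U $ i) (W $ i)))) (at U)"
    by (rule has_derivative_sum, rule has_derivative_mult_right)
       (rule bilinear_has_derivative[OF ext_bilinear comp comp])
  have hart: "((\<lambda>X. \<Sum>i\<in>UNIV. \<Sum>j\<in>UNIV. 4 * hartree (X $ i) (X $ i) (X $ j) (X $ j)) has_derivative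
      (\<lambda>W. \<Sum>i\<in>UNIV. \<Sum>j\<in>UNIV. 4 * (hartree (W $ i) (U $ i) (U $ j) (U $ j)
         + hartree (U $ i) (W $ i) (U $ j) (U $ j) + hartree (U $ i) (U $ i) (W $ j) (U $ j)
         + hartree (U $ i) (U $ i) (U $ j) (W $ j)))) (at U)"
    by (rule has_derivative_sum, rule has_derivative_sum, rule has_derivative_mult_right)
       (rule quadrilinear_has_derivative[OF hartree_linear comp comp])
  have xcd: "((\<lambda>X. xc_energy exc (orbitals \<iota> X)) has_derivative
        (\<lambda>W. LINT r|lborel. vxc (rho (orbitals \<iota> U)) r * (4 * (\<Sum>i\<in>UNIV. \<iota> (U $ i) r * \<iota> (W $ i) r))))
       (at U)"
    using xc by (simp add: xc_differentiable_def)
  have E: "energy \<iota> Vext exc = (\<lambda>X :: 'v^'n. (\<Sum>i\<in>UNIV. kin (X $ i) (X $ i)) + (\<Sum>i\<in>UNIV. 2 * ext (X $ i) (X $ i))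
      + 1 / 2 * (\<Sum>i\<in>UNIV. \<Sum>j\<in>UNIV. 4 * hartree (X $ i) (X $ i) (X $ j) (X $ j))
      + xc_energy exc (orbitals \<iota> X))"
    by (rule HOL.ext) (simp only: energy_def ks_energy_def kinetic_energy external_energy hartree_energy)
  have kin': "(\<Sum>i\<in>UNIV. kin (W $ i) (U $ i) + kin (U $ i) (W $ i)) = (\<Sum>i\<in>UNIV. 2 * kin (U $ i) (W $ i))" for W
    by (simp add: kin_commute[of "W $ _"])
  have ext': "(\<Sum>i\<in>UNIV. 2 * (ext (W $ i) (U $ i) + ext (U $ i) (W $ i))) = (\<Sum>i\<in>UNIV. 4 * ext (U $ i) (W $ i))" for W
  proof -
    have "ext (W $ i) (U $ i) = ext (U $ i) (W $ i)" for i by (simp add: ext_def mult.commute)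
    then show ?thesis by simp
  qed
  \<comment> \<open>The variation falls on one density or the other. By symmetry of the kernel and
    an exchange of \<open>i\<close> and \<open>j\<close> both contributions are equal, so 8 + 8 =
    16.\<close>
  have hart': "(\<Sum>i\<in>UNIV. \<Sum>j\<in>UNIV. 4 * (hartree (W $ i) (U $ i) (U $ j) (U $ j)
         + hartree (U $ i) (W $ i) (U $ j) (U $ j) + hartree (U $ i) (U $ i) (W $ j) (U $ j)
         + hartree (U $ i) (U $ i) (U $ j) (W $ j)))
      = (\<Sum>i\<in>UNIV. \<Sum>j\<in>UNIV. 16 * hartree (U $ i) (W $ i) (U $ j) (U $ j))" for W
  proof -
    have "hartree (W $ i) (U $ i) (U $ j) (U $ j) = hartree (U $ i) (W $ i) (U $ j) (U $ j)" for i j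
      by (rule hartree_commute(1))
    moreover have "hartree (U $ i) (U $ i) (U $ j) (W $ j) = hartree (U $ j) (W $ j) (U $ i) (U $ i)"
      "hartree (U $ i) (U $ i) (W $ j) (U $ j) = hartree (U $ j) (W $ j) (U $ i) (U $ i)" for i j
      by (rule hartree_swap, subst hartree_swap, rule hartree_commute(1))
    ultimately have "(\<Sum>i\<in>UNIV. \<Sum>j\<in>UNIV. 4 * (hartree (W $ i) (U $ i) (U $ j) (U $ j)
         + hartree (U $ i) (W $ i) (U $ j) (U $ j) + hartree (U $ i) (U $ i) (W $ j) (U $ j)
         + hartree (U $ i) (U $ i) (U $ j) (W $ j)))
      = (\<Sum>i\<in>UNIV. \<Sum>j\<in>UNIV. 8 * hartree (U $ i) (W $ i) (U $ j) (U $ j))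
        + (\<Sum>i\<in>UNIV. \<Sum>j\<in>UNIV. 8 * hartree (U $ j) (W $ j) (U $ i) (U $ i))"
      unfolding sum.distrib[symmetric] by (intro sum.cong refl) simp
    also have "(\<Sum>i\<in>UNIV. \<Sum>j\<in>UNIV. 8 * hartree (U $ j) (W $ j) (U $ i) (U $ i))
      = (\<Sum>i\<in>UNIV. \<Sum>j\<in>UNIV. 8 * hartree (U $ i) (W $ i) (U $ j) (U $ j))"
      by (rule sum.swap)
    finally show ?thesis by (simp add: sum.distrib[symmetric])
  qed
  have xc': "(LINT r|lborel. vxc (rho (orbitals \<iota> U)) r * (4 * (\<Sum>i\<in>UNIV. \<iota> (U $ i) r * \<iota> (W $ i) r)))
      = (\<Sum>i\<in>UNIV. 4 * (LINT r|lborel. vxc (rho (orbitals \<iota> U)) r * (\<iota> (U $ i) r * \<iota> (W $ i) r)))" for W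
  proof -
    have "(LINT r|lborel. vxc (rho (orbitals \<iota> U)) r * (4 * (\<Sum>i\<in>UNIV. \<iota> (U $ i) r * \<iota> (W $ i) r)))
      = (LINT r|lborel. (\<Sum>i\<in>UNIV. 4 * (vxc (rho (orbitals \<iota> U)) r * (\<iota> (U $ i) r * \<iota> (W $ i) r))))"
      by (simp add: sum_distrib_left ac_simps)
    also have "\<dots> = (\<Sum>i\<in>UNIV. LINT r|lborel. 4 * (vxc (rho (orbitals \<iota> U)) r * (\<iota> (U $ i) r * \<iota> (W $ i) r)))"
      by (intro Bochner_Integration.integral_sum integrable_mult_right vxc_integrable)
    finally show ?thesis by simp
  qed
  have "(energy \<iota> Vext exc has_derivative (\<lambda>W. (\<Sum>i\<in>UNIV. 2 * kin (U $ i) (W $ i))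
      + (\<Sum>i\<in>UNIV. 4 * ext (U $ i) (W $ i))
      + 1 / 2 * (\<Sum>i\<in>UNIV. \<Sum>j\<in>UNIV. 16 * hartree (U $ i) (W $ i) (U $ j) (U $ j))
      + (\<Sum>i\<in>UNIV. 4 * (LINT r|lborel. vxc (rho (orbitals \<iota> U)) r * (\<iota> (U $ i) r * \<iota> (W $ i) r))))) (at U)"
    unfolding E using has_derivative_add[OF has_derivative_add[OF has_derivative_add[OF kin ext]
        has_derivative_mult_right[OF hart, of "1 / 2"]] xcd]
    unfolding kin' ext' hart' xc' .
  moreover have "(\<Sum>i\<in>UNIV. 2 * kin (U $ i) (W $ i)) + (\<Sum>i\<in>UNIV. 4 * ext (U $ i) (W $ i))
      + 1 / 2 * (\<Sum>i\<in>UNIV. \<Sum>j\<in>UNIV. 16 * hartree (U $ i) (W $ i) (U $ j) (U $ j))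
      + (\<Sum>i\<in>UNIV. 4 * (LINT r|lborel. vxc (rho (orbitals \<iota> U)) r * (\<iota> (U $ i) r * \<iota> (W $ i) r)))
      = grad_E \<iota> Vext vxc U \<bullet> W" for W
    by (simp add: inner_vec_def grad_E_inner ham_def distrib_left sum.distrib sum_distrib_left)
  ultimately show ?thesis by simp
qed

lemma stiefel_iff: "U \<in> stiefel \<iota> \<longleftrightarrow> gram U U = mat 1"
  by (simp add: stiefel_def stiefel_H1_def orbitals_def iota_H1 gram_def iota_inner)

end

section \<open>Gradient flow on the Grassmann manifold\<close>

lemma trace_gram: "trace (gram V W) = V \<bullet> W"
  by (simp add: trace_def gram_def inner_vec_def)

lemma transpose_gram: "transpose (gram V W) = gram W V"
  by (simp add: transpose_def gram_def inner_commute)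

lemma gram_rmul_right: "gram X (Y \<odot> P) = gram X Y ** P"
  by (simp add: gram_def rmul_def matrix_matrix_mult_def vec_eq_iff inner_sum_right mult.commute)

lemma gram_rmul_left: "gram (X \<odot> P) Y = transpose P ** gram X Y"
  by (simp add: gram_def rmul_def matrix_matrix_mult_def transpose_def vec_eq_iff inner_sum_left)

lemma rmul_rmul: "(U \<odot> P) \<odot> Q = U \<odot> (P ** Q)"
proof -
  have "(\<Sum>j\<in>UNIV. Q $ j $ i *\<^sub>R (\<Sum>k\<in>UNIV. P $ k $ j *\<^sub>R U $ k))
      = (\<Sum>k\<in>UNIV. (\<Sum>j\<in>UNIV. P $ k $ j * Q $ j $ i) *\<^sub>R U $ k)" for i
    unfolding scaleR_sum_right scaleR_sum_left by (subst sum.swap) (simp add: mult.commute)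
  then show ?thesis by (simp add: rmul_def matrix_matrix_mult_def vec_eq_iff)
qed

lemma rmul_mat_1: "U \<odot> mat 1 = U"
  by (simp add: rmul_def mat_def vec_eq_iff if_distrib[of "\<lambda>c. c *\<^sub>R _"] cong: if_cong)

lemma bilinear_gram: "bilinear (gram :: 'v::euclidean_space^'n::finite \<Rightarrow> 'v^'n \<Rightarrow> real^'n^'n)"
  by (rule bilinearI) (simp_all add: gram_def vec_eq_iff inner_add_left inner_add_right)

lemma bilinear_rmul: "bilinear ((\<odot>) :: 'v::euclidean_space^'n::finite \<Rightarrow> real^'n^'n \<Rightarrow> 'v^'n)"
  by (rule bilinearI)
     (simp_all add: rmul_def vec_eq_iff scaleR_add_left scaleR_add_right sum.distrib scaleR_sum_right mult.commute)

lemma bounded_bilinear_gram: "bounded_bilinear (gram :: 'v::euclidean_space^'n::finite \<Rightarrow> 'v^'n \<Rightarrow> real^'n^'n)"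
  using bilinear_gram bilinear_conv_bounded_bilinear by blast

lemma bounded_bilinear_rmul: "bounded_bilinear ((\<odot>) :: 'v::euclidean_space^'n::finite \<Rightarrow> real^'n^'n \<Rightarrow> 'v^'n)"
  using bilinear_rmul bilinear_conv_bounded_bilinear by blast

lemma trace_gram_mult: "trace (gram V W ** A) = V \<bullet> (W \<odot> A)"
  unfolding gram_rmul_right[symmetric] trace_gram ..

lemma norm_rmul:
  fixes U :: "'v::euclidean_space^'n::finite"
  assumes "orthogonal_matrix P"
  shows "norm (U \<odot> P) = norm U"
proof -
  have "bilinear (\<lambda>x y :: 'v. x \<bullet> y)"
    by (rule bilinearI) (simp_all add: inner_add_left inner_add_right)
  from bilinear_rmul_invariant[OF this assms, of U]
  have "(U \<odot> P) \<bullet> (U \<odot> P) = U \<bullet> U" by (simp add: inner_vec_def)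
  then show ?thesis by (simp add: norm_eq_sqrt_inner)
qed

lemma rmul_orthogonal_cancel:
  assumes "orthogonal_matrix P"
  shows "U \<odot> P \<odot> transpose P = U" "U \<odot> transpose P \<odot> P = U"
  using assms by (simp_all add: rmul_rmul orthogonal_matrix_def rmul_mat_1)

lemma gram_rmul_orthogonal:
  assumes "orthogonal_matrix P" "gram X X = mat 1"
  shows "gram (X \<odot> P) (X \<odot> P) = mat 1"
  using assms by (simp add: gram_rmul_left gram_rmul_right orthogonal_matrix_def)

section \<open>The distance between classes\<close>

lemma gdist_le: "orthogonal_matrix P \<Longrightarrow> gdist U X \<le> norm (U - X \<odot> P)"
  unfolding gdist_def by (rule cINF_lower) (auto intro!: bdd_belowI[of _ 0])

lemma gdist_greatest: "(\<And>P. orthogonal_matrix P \<Longrightarrow> c \<le> norm (U - X \<odot> P)) \<Longrightarrow> c \<le> gdist U X"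
  unfolding gdist_def by (rule cINF_greatest) (auto intro: orthogonal_matrix_id)

lemma gdist_nonneg: "0 \<le> gdist U X"
  by (rule gdist_greatest) simp

lemma gdist_lessE:
  assumes "gdist U X < \<delta>"
  obtains P where "orthogonal_matrix P" "norm (U - X \<odot> P) < \<delta>"
  using gdist_greatest[of \<delta> U X] assms by force

text \<open>Right multiplication by an orthogonal matrix is an isometry, so the same
  \<open>P\<close> can be used for \<open>X\<close> and \<open>Y\<close>. The distance is therefore
  1-Lipschitz in its second argument.\<close>

lemma gdist_triangle:
  fixes U X Y :: "'v::euclidean_space^'n::finite"
  shows "gdist U X \<le> gdist U Y + norm (X - Y)"
proof -
  have "gdist U X - norm (X - Y) \<le> gdist U Y"
  proof (rule gdist_greatest)
    fix P :: "real^'n^'n" assume P: "orthogonal_matrix P"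
    have "U - X \<odot> P = (U - Y \<odot> P) - (X - Y) \<odot> P"
      by (simp add: bounded_bilinear.diff_left[OF bounded_bilinear_rmul])
    then have "norm (U - X \<odot> P) \<le> norm (U - Y \<odot> P) + norm ((X - Y) \<odot> P)"
      by (simp only: norm_triangle_ineq4)
    then have "norm (U - X \<odot> P) \<le> norm (U - Y \<odot> P) + norm (X - Y)"
      by (simp only: norm_rmul[OF P])
    then show "gdist U X - norm (X - Y) \<le> norm (U - Y \<odot> P)"
      using gdist_le[OF P, of U X] by simp
  qed
  then show ?thesis by simp
qed

lemma continuous_on_gdist: "continuous_on S (gdist U)"
proof (rule continuous_onI)
  fix x e assume "0 < (e::real)"
  moreover have "dist (gdist U y) (gdist U x) \<le> dist y x" for y
    using gdist_triangle[of U x y] gdist_triangle[of U y x]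
    by (simp add: dist_norm norm_minus_commute abs_le_iff)
  ultimately show "\<exists>d>0. \<forall>y\<in>S. dist y x < d \<longrightarrow> dist (gdist U y) (gdist U x) \<le> e"
    by (intro exI[of _ e]) (force intro: order_trans)
qed

text \<open>Multiplication by \<open>Q\<close> permutes the matrices over which the infimum runs.
  One inequality suffices, because \<open>transpose Q\<close> undoes \<open>Q\<close>.\<close>

lemma gdist_rmul:
  fixes U X :: "'v::euclidean_space^'n::finite"
  assumes "orthogonal_matrix Q"
  shows "gdist U (X \<odot> Q) = gdist U X"
proof -
  have le: "gdist U (X \<odot> Q) \<le> gdist U X" if Q: "orthogonal_matrix Q"
    for X :: "'v^'n" and Q
  proof (rule gdist_greatest)
    fix P :: "real^'n^'n" assume P: "orthogonal_matrix P"
    have "gdist U (X \<odot> Q) \<le> norm (U - X \<odot> Q \<odot> (transpose Q ** P))"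
      by (intro gdist_le orthogonal_matrix_mul) (use P Q in simp_all)
    also have "X \<odot> Q \<odot> (transpose Q ** P) = X \<odot> P"
      by (simp only: rmul_rmul[symmetric] rmul_orthogonal_cancel[OF Q])
    finally show "gdist U (X \<odot> Q) \<le> norm (U - X \<odot> P)" .
  qed
  from le[of "transpose Q" "X \<odot> Q"] le[OF assms, of X] show ?thesis
    using assms by (simp add: rmul_orthogonal_cancel)
qed

lemma gdist_self_rmul: "orthogonal_matrix P \<Longrightarrow> gdist U (U \<odot> P) = 0"
  using gdist_le[OF orthogonal_matrix_id, of U U] gdist_nonneg[of U U]
  by (simp add: gdist_rmul rmul_mat_1)

lemma gclass_eqE:
  assumes "gclass X = gclass Y"
  obtains P where "orthogonal_matrix P" "X = Y \<odot> P"
proof -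
  have "X \<in> gclass X" unfolding gclass_def using orthogonal_matrix_id rmul_mat_1[of X] by force
  then show ?thesis using assms that by (auto simp: gclass_def)
qed

text \<open>Membership only provides some representative of the class, but orthonormality and
  distance do not depend on the representative. This lets frames replace classes in the analysis of
  the flow.\<close>

lemma gclass_in_gball_iff:
  fixes X U :: "'v::euclidean_space^'n::finite"
  assumes "\<And>X :: 'v^'n. X \<in> stiefel \<iota> \<longleftrightarrow> gram X X = mat 1"
  shows "gclass X \<in> gball \<iota> U \<delta> \<longleftrightarrow> gram X X = mat 1 \<and> gdist U X \<le> \<delta>"
proof
  assume "gclass X \<in> gball \<iota> U \<delta>"
  then obtain Y where Y: "gclass X = gclass Y" "gram Y Y = mat 1" "gdist U Y \<le> \<delta>"
    unfolding gball_def mem_Collect_eq assms by (elim exE conjE) (rule that)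
  obtain P where "orthogonal_matrix P" "X = Y \<odot> P" using Y(1) by (rule gclass_eqE)
  then show "gram X X = mat 1 \<and> gdist U X \<le> \<delta>"
    using Y by (simp add: gdist_rmul gram_rmul_orthogonal)
next
  assume "gram X X = mat 1 \<and> gdist U X \<le> \<delta>"
  then show "gclass X \<in> gball \<iota> U \<delta>" unfolding gball_def mem_Collect_eq assms by (intro exI[of _ X]) simp
qed

text \<open>The trace of the Gram matrix is the squared norm, so all orthonormal frames lie on one
  sphere; the constraint is closed and the space finite-dimensional.\<close>

lemma compact_orthonormal_frames: "compact {X :: 'v::euclidean_space^'n::finite. gram X X = mat 1}"
proof (rule compact_eq_bounded_closed[THEN iffD2], rule conjI)
  have "norm X = sqrt CARD('n)" if "gram X X = mat 1" for X :: "'v^'n"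
    using trace_gram[of X X] that by (simp add: norm_eq_sqrt_inner trace_I)
  then show "bounded {X :: 'v^'n. gram X X = mat 1}"
    by (auto simp: bounded_iff)
  show "closed {X :: 'v^'n. gram X X = mat 1}"
    by (intro closed_Collect_eq bounded_bilinear.continuous_on[OF bounded_bilinear_gram] continuous_intros)
qed

section \<open>Grassmann gradient and critical points of an invariant energy\<close>

locale grassmann_energy =
  fixes E :: "'v::euclidean_space^'n::finite \<Rightarrow> real" and g :: "'v^'n \<Rightarrow> 'v^'n"
  assumes E_has_derivative: "\<And>X. (E has_derivative (\<lambda>W. g X \<bullet> W)) (at X)"
    and gram_g_symmetric: "\<And>X. transpose (gram X (g X)) = gram X (g X)"
    and E_rmul: "\<And>P X. orthogonal_matrix P \<Longrightarrow> E (X \<odot> P) = E X"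
    and g_rmul: "\<And>P X. orthogonal_matrix P \<Longrightarrow> g (X \<odot> P) = g X \<odot> P"
begin

lemma continuous_on_E: "continuous_on S E"
  by (meson E_has_derivative continuous_at_imp_continuous_on has_derivative_continuous)

lemma gram_grad_G: "gram X (grad_G g X) = gram X (g X) ** gram X X - gram X X ** gram X (g X)"
  by (simp add: grad_G_def bounded_bilinear.diff_right[OF bounded_bilinear_gram] gram_rmul_right)

text \<open>\<open>gram X (grad_G g X)\<close> is a commutator of two symmetric matrices, hence
  skew. Orthonormality of \<open>X\<close> must not be presupposed, since this identity is what
  proves it along the flow.\<close>

lemma gram_grad_G_sym: "gram (grad_G g X) X + gram X (grad_G g X) = 0"
proof -
  have "gram (grad_G g X) X = transpose (gram X (grad_G g X))" by (rule transpose_gram[symmetric])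
  also have "\<dots> = gram X X ** gram X (g X) - gram X (g X) ** gram X X"
  proof -
    have "transpose (A - B) = transpose A - transpose B" for A B :: "real^'n^'n"
      by (simp add: transpose_def vec_eq_iff)
    then show ?thesis
      by (simp only: gram_grad_G matrix_transpose_mul gram_g_symmetric transpose_gram[of X X])
  qed
  finally show ?thesis by (simp add: gram_grad_G)
qed

lemma grad_G_tangent:
  assumes "gram X X = mat 1"
  shows "gram X (grad_G g X) = 0" "gram (grad_G g X) X = 0"
  using gram_grad_G_sym[of X] by (simp_all add: gram_grad_G assms)

lemma grad_G_orthonormal:
  assumes "gram X X = mat 1"
  shows "grad_G g X = g X - X \<odot> gram X (g X)"
  by (simp add: grad_G_def assms rmul_mat_1)

text \<open>The gradient \<open>g X\<close> differs from \<open>grad_G g X\<close> by a term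
  \<open>X \<odot> A\<close>, which is orthogonal to tangent vectors. This is the source of the
  dissipation rate.\<close>

lemma g_inner_grad_G:
  assumes "gram X X = mat 1"
  shows "g X \<bullet> grad_G g X = (norm (grad_G g X))\<^sup>2"
proof -
  have "X \<odot> A \<bullet> grad_G g X = 0" for A
    using trace_gram_mult[of "grad_G g X" X A] grad_G_tangent[OF assms]
    by (simp add: inner_commute trace_def matrix_matrix_mult_def)
  then show ?thesis
    using grad_G_orthonormal[OF assms] by (metis add.right_neutral diff_add_cancel inner_add_left power2_norm_eq_inner add.commute)
qed

text \<open>Continuity is assumed in a ball of frames around \<open>Us\<close>. Some rotation of
  \<open>X\<close> lies in its interior, and equivariance carries continuity back to
  \<open>X\<close>.\<close>

lemma isCont_g:
  assumes cont: "continuous_on (cball Us \<delta>) g" and X: "gdist Us X < \<delta>"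
  shows "isCont g X"
proof -
  obtain P where P: "orthogonal_matrix P" "norm (Us - X \<odot> P) < \<delta>" using X by (rule gdist_lessE)
  have eq: "g = (\<lambda>Y. g (Y \<odot> P) \<odot> transpose P)"
    using P(1) by (simp add: fun_eq_iff g_rmul rmul_orthogonal_cancel)
  have c: "isCont g (X \<odot> P)"
    using P(2) by (intro continuous_on_interior[OF cont]) (simp add: interior_cball dist_norm)
  have r: "isCont (\<lambda>Y :: 'v^'n. Y \<odot> Q) Y" for Q Y
    by (intro bounded_linear.isCont[OF bounded_bilinear.bounded_linear_left[OF bounded_bilinear_rmul]] continuous_ident)
  have "isCont (\<lambda>Y. g (Y \<odot> P) \<odot> transpose P) X"
    using isCont_o2[OF isCont_o2[OF r c] r] .
  then show ?thesis using eq by simp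
qed

lemma isCont_grad_G: "isCont g X \<Longrightarrow> isCont (grad_G g) X"
  unfolding grad_G_def[abs_def]
  by (intro continuous_intros bounded_bilinear.continuous[OF bounded_bilinear_rmul]
      bounded_bilinear.continuous[OF bounded_bilinear_gram]) auto

text \<open>A nonzero column \<open>w\<close> of the Grassmann gradient is orthogonal to all columns of \<open>X\<close>, so
  rotating the corresponding column of \<open>X\<close> towards \<open>w\<close> stays on the Stiefel manifold and changes
  the energy to first order.\<close>

lemma interior_minimum_critical:
  assumes X: "gram X X = mat 1" and near: "gdist Us X < \<delta>"
    and min: "\<And>Y. gram Y Y = mat 1 \<Longrightarrow> gdist Us Y \<le> \<delta> \<Longrightarrow> E X \<le> E Y"
  shows "grad_G g X = 0"
proof (rule ccontr)
  define W where "W = grad_G g X"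
  assume "grad_G g X \<noteq> 0"
  then obtain i where i: "W $ i \<noteq> 0" by (auto simp: W_def vec_eq_iff)
  define e where "e = W $ i /\<^sub>R norm (W $ i)"
  have ee: "e \<bullet> e = 1" using i by (simp add: e_def dot_square_norm power2_eq_square)
  have "W $ i \<bullet> X $ k = 0" for k
    using grad_G_tangent(2)[OF X] by (simp add: gram_def W_def vec_eq_iff)
  then have eX: "e \<bullet> X $ k = 0" "X $ k \<bullet> e = 0" for k
    by (simp_all add: e_def inner_commute[of "X $ k"])
  have XX: "X $ k \<bullet> X $ l = (if k = l then 1 else 0)" for k l
    using X by (simp add: gram_def mat_def vec_eq_iff)
  define Y where "Y s = X + (cos s - 1) *\<^sub>R axis i (X $ i) + sin s *\<^sub>R axis i e" for s
  have Yi: "Y s $ k = (if k = i then cos s *\<^sub>R X $ i + sin s *\<^sub>R e else X $ k)" for s k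
    by (simp add: Y_def axis_def scaleR_diff_left)
  have YY: "gram (Y s) (Y s) = mat 1" for s
  proof -
    have "Y s $ k \<bullet> Y s $ l = (if k = l then 1 else 0)" for k l
      using sin_cos_squared_add2[of s]
      by (auto simp: Yi XX eX ee inner_add_left inner_add_right power2_eq_square)
    then show ?thesis by (simp add: gram_def mat_def vec_eq_iff)
  qed
  have Y0: "Y 0 = X" by (simp add: Y_def)
  have dY: "(Y has_vector_derivative axis i e) (at 0)"
    unfolding Y_def[abs_def] by (auto intro!: derivative_eq_intros)
  have "((E \<circ> Y) has_vector_derivative g (Y 0) \<bullet> axis i e) (at 0)"
    by (intro vector_derivative_diff_chain_within dY has_derivative_at_withinI[OF E_has_derivative])
  then have D: "DERIV (E \<circ> Y) 0 :> g X $ i \<bullet> e"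
    by (simp add: has_real_derivative_iff_has_vector_derivative Y0 inner_axis)
  have "continuous (at 0) Y" using dY by (rule has_vector_derivative_continuous)
  then obtain d where d: "d > 0" "\<And>s. \<bar>s\<bar> < d \<Longrightarrow> norm (Y s - X) < \<delta> - gdist Us X"
    using near unfolding continuous_at_eps_delta dist_norm Y0
    by (metis diff_gt_0_iff_gt diff_zero real_norm_def)
  have "(E \<circ> Y) 0 \<le> (E \<circ> Y) s" if "\<bar>0 - s\<bar> < d" for s
  proof -
    have "gdist Us (Y s) \<le> \<delta>" using gdist_triangle[of Us "Y s" X] d(2)[of s] that by simp
    then show ?thesis using min[OF YY] by (simp add: Y0)
  qed
  then have "g X $ i \<bullet> e = 0" using DERIV_local_min[OF D d(1)] by blast
  \<comment> \<open>The correction lies in the span of the columns of \<open>X\<close>, to which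
    \<open>e\<close> is orthogonal, so the derivative along the curve is the norm of
    \<open>W $ i\<close>.\<close>
  moreover have "g X $ i = W $ i + (\<Sum>j\<in>UNIV. gram X (g X) $ j $ i *\<^sub>R X $ j)"
    using grad_G_orthonormal[OF X] by (simp add: W_def rmul_def)
  then have "g X $ i \<bullet> e = norm (W $ i)"
    using i by (simp add: inner_add_left inner_sum_left eX) (simp add: e_def dot_square_norm power2_eq_square)
  ultimately show False using i by simp
qed

end

section \<open>Trapping of the flow and convergence to the minimizing class\<close>

locale grassmann_flow = grassmann_energy E g
  for E :: "'v::euclidean_space^'n::finite \<Rightarrow> real" and g +
  fixes Us :: "'v^'n" and \<delta>\<^sub>1 \<delta>\<^sub>2 E\<^sub>0 :: real and U :: "real \<Rightarrow> 'v^'n"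
  assumes Us: "gram Us Us = mat 1"
    and unique: "\<And>X. gram X X = mat 1 \<Longrightarrow> gdist Us X \<le> \<delta>\<^sub>1 \<Longrightarrow> grad_G g X = 0 \<Longrightarrow>
      \<exists>P. orthogonal_matrix P \<and> X = Us \<odot> P"
    and cont_g: "continuous_on (cball Us \<delta>\<^sub>1) g"
    and delta: "0 < \<delta>\<^sub>2" "\<delta>\<^sub>2 < \<delta>\<^sub>1"
    and annulus: "\<And>X. gram X X = mat 1 \<Longrightarrow> \<delta>\<^sub>2 < gdist Us X \<Longrightarrow> gdist Us X \<le> \<delta>\<^sub>1 \<Longrightarrow> E\<^sub>0 \<le> E X"
    and start: "gram (U 0) (U 0) = mat 1" "gdist Us (U 0) \<le> \<delta>\<^sub>2"
    and level: "E Us \<le> E (U 0)" "E (U 0) \<le> (E\<^sub>0 + E Us) / 2"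
    and flow_cont: "continuous_on {0..} U"
    and flow: "\<And>t. t > 0 \<Longrightarrow> (U has_vector_derivative - grad_G g (U t)) (at t)"
begin

text \<open>Compactness provides a minimizer over the larger ball. In the interior it is critical
  and so belongs to the class of \<open>Us\<close>; on the boundary its energy is at least
  \<open>E\<^sub>0\<close>, and the two parts of \<open>level\<close> together give
  \<open>E Us \<le> E\<^sub>0\<close>.\<close>

lemma E_Us_minimal:
  assumes X: "gram X X = mat 1" "gdist Us X \<le> \<delta>\<^sub>1"
  shows "E Us \<le> E X"
proof -
  define K where "K = {X \<in> {X. gram X X = mat 1}. gdist Us X \<le> \<delta>\<^sub>1}"
  have "K = {X. gram X X = mat 1} \<inter> {X. gdist Us X \<le> \<delta>\<^sub>1}" by (auto simp: K_def)
  then have "compact K"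
    using compact_orthonormal_frames closed_Collect_le[OF continuous_on_gdist continuous_on_const]
    by (auto intro: compact_Int_closed)
  moreover have "X \<in> K" using X by (simp add: K_def)
  ultimately obtain Y where Y: "Y \<in> K" "\<And>Z. Z \<in> K \<Longrightarrow> E Y \<le> E Z"
    using continuous_attains_inf[of K E] continuous_on_E by blast
  have YK: "gram Y Y = mat 1" "gdist Us Y \<le> \<delta>\<^sub>1" using Y(1) by (auto simp: K_def)
  have "E Us \<le> E Y"
  proof (cases "gdist Us Y < \<delta>\<^sub>1")
    case True
    have "grad_G g Y = 0"
      using Y(2) by (intro interior_minimum_critical[OF YK(1) True]) (simp add: K_def)
    then obtain P where "orthogonal_matrix P" "Y = Us \<odot> P" using unique[OF YK] by blast
    then show ?thesis by (simp add: E_rmul)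
  next
    case False
    then have "E\<^sub>0 \<le> E Y" using annulus[OF YK(1)] YK delta by simp
    then show ?thesis using level by simp
  qed
  then show ?thesis using Y(2)[OF \<open>X \<in> K\<close>] by simp
qed

text \<open>An interior point with the minimal value is itself a minimizer, hence critical, and
  uniqueness applies.\<close>

lemma E_eq_E_Us_imp_gdist_0:
  assumes X: "gram X X = mat 1" "gdist Us X < \<delta>\<^sub>1" "E X = E Us"
  shows "gdist Us X = 0"
proof -
  have "grad_G g X = 0"
    using interior_minimum_critical[OF X(1,2)] E_Us_minimal X(3) by simp
  then obtain P where "orthogonal_matrix P" "X = Us \<odot> P" using unique X by force
  then show ?thesis by (simp add: gdist_self_rmul)
qed

text \<open>By \<open>gram_grad_G_sym\<close> every entry of the Gram matrix has zero derivative.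
  The equation holds for positive times only, so continuity at 0 links the entries to the initial
  frame.\<close>

lemma flow_orthonormal:
  assumes "t \<ge> 0"
  shows "gram (U t) (U t) = mat 1"
proof (cases "t = 0")
  case False
  then have t: "0 < t" using assms by simp
  have "gram (U t) (U t) $ i $ j = gram (U 0) (U 0) $ i $ j" for i j
  proof (rule DERIV_isconst_end[OF t])
    show "continuous_on {0..t} (\<lambda>s. gram (U s) (U s) $ i $ j)"
      by (intro continuous_intros bounded_bilinear.continuous_on[OF bounded_bilinear_gram]
          continuous_on_subset[OF flow_cont]) auto
    fix s assume s: "0 < s" "s < t"
    have "((\<lambda>s. gram (U s) (U s)) has_vector_derivative
        gram (U s) (- grad_G g (U s)) + gram (- grad_G g (U s)) (U s)) (at s)"
      by (intro bounded_bilinear.has_vector_derivative[OF bounded_bilinear_gram] flow s)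
    moreover have "gram (U s) (- grad_G g (U s)) + gram (- grad_G g (U s)) (U s) = 0"
      using gram_grad_G_sym[of "U s"]
      by (simp add: bounded_bilinear.minus_left[OF bounded_bilinear_gram]
          bounded_bilinear.minus_right[OF bounded_bilinear_gram] add.commute) (metis add.commute add_eq_0_iff neg_equal_iff_equal)
    ultimately have d: "((\<lambda>s. gram (U s) (U s)) has_vector_derivative 0) (at s)" by simp
    have "((\<lambda>s. gram (U s) (U s) $ i $ j) has_vector_derivative (0 $ i $ j)) (at s)"
      by (intro bounded_linear.has_vector_derivative[OF bounded_linear_vec_nth] d)
    then show "DERIV (\<lambda>s. gram (U s) (U s) $ i $ j) s :> 0"
      by (simp add: has_real_derivative_iff_has_vector_derivative)
  qed
  then show ?thesis using start(1) by (simp add: vec_eq_iff)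
qed (use start in simp)

lemma energy_along_flow:
  assumes "t > 0"
  shows "DERIV (\<lambda>t. E (U t)) t :> - (norm (grad_G g (U t)))\<^sup>2"
proof -
  have "((E \<circ> U) has_vector_derivative g (U t) \<bullet> (- grad_G g (U t))) (at t)"
    by (intro vector_derivative_diff_chain_within flow has_derivative_at_withinI[OF E_has_derivative] assms)
  then show ?thesis
    using g_inner_grad_G[OF flow_orthonormal, of t] assms
    by (simp add: has_real_derivative_iff_has_vector_derivative o_def)
qed

lemma continuous_on_E_flow: "S \<subseteq> {0..} \<Longrightarrow> continuous_on S (\<lambda>t. E (U t))"
  by (rule continuous_on_compose2[OF continuous_on_E continuous_on_subset[OF flow_cont], of _ UNIV]) auto

lemma energy_decreasing:
  assumes "0 \<le> a" "a \<le> b"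
  shows "E (U b) \<le> E (U a)"
proof (rule DERIV_nonpos_imp_decreasing_open[OF assms(2)])
  show "\<exists>y. DERIV (\<lambda>t. E (U t)) x :> y \<and> y \<le> 0" if "a < x" "x < b" for x
    using energy_along_flow[of x] that assms by force
  show "continuous_on {a..b} (\<lambda>t. E (U t))" using assms by (intro continuous_on_E_flow) auto
qed

text \<open>Escape would pass through a distance strictly between the two radii. There the energy is
  at least \<open>E\<^sub>0\<close> and at most the mean of \<open>E\<^sub>0\<close> and
  \<open>E Us\<close>, which with minimality forces it to equal \<open>E Us\<close>; then the
  distance is 0, a contradiction.\<close>

lemma flow_in_ball:
  assumes "t \<ge> 0"
  shows "gdist Us (U t) \<le> \<delta>\<^sub>2"
proof (rule ccontr)
  assume far: "\<not> gdist Us (U t) \<le> \<delta>\<^sub>2"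
  \<comment> \<open>The cap at the midpoint keeps \<open>c\<close> below
    \<open>\<delta>\<^sub>1\<close> even if \<open>U t\<close> is far outside the larger
    ball.\<close>
  define c where "c = min (gdist Us (U t)) ((\<delta>\<^sub>1 + \<delta>\<^sub>2) / 2)"
  have c: "\<delta>\<^sub>2 < c" "c < \<delta>\<^sub>1" "c \<le> gdist Us (U t)"
    using far delta by (auto simp: c_def min_def field_simps)
  have "continuous_on {0..t} (\<lambda>s. gdist Us (U s))"
    by (rule continuous_on_compose2[OF continuous_on_gdist continuous_on_subset[OF flow_cont], of _ UNIV]) auto
  then obtain s where s: "0 \<le> s" "s \<le> t" "gdist Us (U s) = c"
    using IVT'[of "\<lambda>s. gdist Us (U s)" 0 c t] c start assms by force
  note on = flow_orthonormal[OF s(1)]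
  have "E\<^sub>0 \<le> E (U s)" using annulus[OF on] s c by simp
  then have "E (U s) = E Us"
    using energy_decreasing[OF order_refl s(1)] level E_Us_minimal[OF on] s c by simp
  then show False using E_eq_E_Us_imp_gdist_0[OF on] s c delta by simp
qed

lemma compact_superlevel:
  fixes f :: "'v^'n \<Rightarrow> real"
  assumes "continuous_on UNIV f"
  shows "compact {X. gram X X = mat 1 \<and> gdist Us X \<le> \<delta>\<^sub>2 \<and> c \<le> f X}"
proof -
  have "{X. gram X X = mat 1 \<and> gdist Us X \<le> \<delta>\<^sub>2 \<and> c \<le> f X}
      = {X. gram X X = mat 1} \<inter> ({X. gdist Us X \<le> \<delta>\<^sub>2} \<inter> {X. c \<le> f X})" by auto
  then show ?thesis
    using compact_orthonormal_frames closed_Collect_le[OF continuous_on_gdist continuous_on_const]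
      closed_Collect_le[OF continuous_on_const assms]
    by (auto intro!: compact_Int_closed closed_Int)
qed

text \<open>Otherwise the flow stays in a compact set \<open>K\<close> without critical points,
  because the only critical class in the ball has energy \<open>E Us\<close>. The squared gradient
  norm then has a positive minimum \<open>m\<close> on \<open>K\<close>, and the energy falls at
  least at rate \<open>m\<close> forever.\<close>

lemma energy_tendsto:
  assumes e: "e > 0"
  shows "\<exists>T\<ge>0. \<forall>t\<ge>T. E (U t) < E Us + e"
proof (rule ccontr)
  assume neg: "\<not> ?thesis"
  have high: "E Us + e \<le> E (U t)" if t: "t \<ge> 0" for t
  proof (rule ccontr)
    assume "\<not> ?thesis"
    then have "\<forall>s\<ge>t. E (U s) < E Us + e" using energy_decreasing[OF t] by force
    then show False using neg t by blast
  qed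
  define K where "K = {X. gram X X = mat 1 \<and> gdist Us X \<le> \<delta>\<^sub>2 \<and> E Us + e \<le> E X}"
  have UK: "U t \<in> K" if "t \<ge> 0" for t
    using that high flow_orthonormal flow_in_ball by (simp add: K_def)
  have "continuous_on K (\<lambda>X. (norm (grad_G g X))\<^sup>2)"
  proof (intro continuous_intros continuous_at_imp_continuous_on ballI isCont_grad_G)
    fix X assume "X \<in> K"
    then show "isCont g X" using delta by (intro isCont_g[OF cont_g]) (auto simp: K_def)
  qed
  moreover have "compact K" unfolding K_def by (rule compact_superlevel[OF continuous_on_E])
  ultimately obtain Y where Y: "Y \<in> K" "\<And>X. X \<in> K \<Longrightarrow> (norm (grad_G g Y))\<^sup>2 \<le> (norm (grad_G g X))\<^sup>2"
    using continuous_attains_inf[of K "\<lambda>X. (norm (grad_G g X))\<^sup>2"] UK[of 0] by force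
  define m where "m = (norm (grad_G g Y))\<^sup>2"
  have "grad_G g Y \<noteq> 0"
  proof
    assume "grad_G g Y = 0"
    then obtain P where "orthogonal_matrix P" "Y = Us \<odot> P"
      using unique[of Y] Y(1) delta by (force simp: K_def)
    then show False using Y(1) e by (simp add: K_def E_rmul)
  qed
  then have m: "m > 0" by (simp add: m_def)
  have bound: "E (U t) + m * t \<le> E (U 0) + m * 0" if "t \<ge> 0" for t
  proof (rule DERIV_nonpos_imp_decreasing_open[OF that, of "\<lambda>t. E (U t) + m * t"])
    show "\<exists>y. DERIV (\<lambda>t. E (U t) + m * t) x :> y \<and> y \<le> 0" if "0 < x" "x < t" for x
    proof (intro exI conjI)
      show "DERIV (\<lambda>t. E (U t) + m * t) x :> - (norm (grad_G g (U x)))\<^sup>2 + m"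
        using energy_along_flow[OF that(1)] by (auto intro!: derivative_eq_intros)
      show "- (norm (grad_G g (U x)))\<^sup>2 + m \<le> 0"
        using Y(2)[OF UK[of x]] that by (simp add: m_def)
    qed
    show "continuous_on {0..t} (\<lambda>t. E (U t) + m * t)"
      by (intro continuous_intros continuous_on_E_flow) auto
  qed
  \<comment> \<open>At this time linear decay has used up the whole gap above
    \<open>E Us\<close>.\<close>
  define t where "t = (E (U 0) - E Us) / m"
  have "t \<ge> 0" using m level by (simp add: t_def)
  from bound[OF this] high[OF this] e show False using m by (simp add: t_def)
qed

text \<open>On the compact part of the ball at distance at least \<open>\<eta>\<close> the energy
  exceeds \<open>E Us\<close> by a fixed gap, and eventually the energy is below that gap.\<close>

lemma gdist_flow_tendsto:
  assumes \<eta>: "\<eta> > 0"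
  shows "\<exists>T\<ge>0. \<forall>t\<ge>T. gdist Us (U t) < \<eta>"
proof -
  define K where "K = {X. gram X X = mat 1 \<and> gdist Us X \<le> \<delta>\<^sub>2 \<and> \<eta> \<le> gdist Us X}"
  have K: "compact K" unfolding K_def by (rule compact_superlevel[OF continuous_on_gdist])
  obtain e where e: "e > 0" "\<And>X. X \<in> K \<Longrightarrow> E Us + e \<le> E X"
  proof (cases "K = {}")
    case False
    then obtain Y where Y: "Y \<in> K" "\<And>X. X \<in> K \<Longrightarrow> E Y \<le> E X"
      using continuous_attains_inf[OF K _ continuous_on_E] by blast
    have "gram Y Y = mat 1" "gdist Us Y < \<delta>\<^sub>1" "gdist Us Y \<noteq> 0"
      using Y(1) \<eta> delta by (auto simp: K_def)
    then have "E Us < E Y"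
      using E_eq_E_Us_imp_gdist_0[of Y] E_Us_minimal[of Y] by force
    then show ?thesis using Y(2) by (intro that[of "E Y - E Us"]) auto
  qed (use that[of 1] in simp)
  obtain T where T: "T \<ge> 0" "\<And>t. t \<ge> T \<Longrightarrow> E (U t) < E Us + e"
    using energy_tendsto[OF e(1)] by blast
  have "gdist Us (U t) < \<eta>" if "t \<ge> T" for t
  proof (rule ccontr)
    assume "\<not> ?thesis"
    then have "U t \<in> K" using that T(1) flow_orthonormal flow_in_ball by (simp add: K_def)
    then show False using e(2) T(2)[OF that] by force
  qed
  then show ?thesis using T(1) by blast
qed

text \<open>On orthonormal frames the gradient is \<open>g X - X \<odot> gram X (g X)\<close>.
  Differentiated along the flow and paired with the tangent vector \<open>W\<close>, it yields minus
  the Hessian form in \<open>W\<close>.\<close>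

lemma norm_grad_along_flow:
  assumes t: "t > 0" and diff: "g differentiable (at (U t))"
  shows "DERIV (\<lambda>t. (norm (grad_G g (U t)))\<^sup>2) t :> - 2 * hess_G g (U t) (grad_G g (U t)) (grad_G g (U t))"
proof -
  define W where "W = grad_G g (U t)"
  define A where "A = gram (U t) (g (U t))"
  define g' where "g' = frechet_derivative g (at (U t))"
  have g': "(g has_derivative g') (at (U t))"
    using diff by (simp add: g'_def frechet_derivative_works[symmetric])
  have lin: "g' (- W) = - g' W" using has_derivative_linear[OF g'] by (rule linear_neg)
  have on: "gram (U t) (U t) = mat 1" using t by (intro flow_orthonormal) simp
  have dU: "(U has_vector_derivative - W) (at t)" unfolding W_def by (rule flow[OF t])
  have dg: "((\<lambda>s. g (U s)) has_vector_derivative - g' W) (at t)"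
    using vector_derivative_diff_chain_within[OF dU has_derivative_at_withinI[OF g']]
    by (simp add: lin o_def)
  \<comment> \<open>The value of \<open>A'\<close> is irrelevant: it enters only through
    \<open>U t \<odot> A'\<close>, which is orthogonal to \<open>W\<close>.\<close>
  obtain A' where dA: "((\<lambda>s. gram (U s) (g (U s))) has_vector_derivative A') (at t)"
    using bounded_bilinear.has_vector_derivative[OF bounded_bilinear_gram dU dg] by blast
  have "((\<lambda>s. g (U s) - U s \<odot> gram (U s) (g (U s))) has_vector_derivative
      - g' W - (U t \<odot> A' + (- W) \<odot> A)) (at t)"
    unfolding A_def
    by (intro has_vector_derivative_diff dg bounded_bilinear.has_vector_derivative[OF bounded_bilinear_rmul] dU dA)
  \<comment> \<open>The shortened formula agrees with \<open>grad_G\<close> only on orthonormal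
    frames, so the two are exchanged on the open set of positive times.\<close>
  then have dF: "((\<lambda>s. grad_G g (U s)) has_vector_derivative - g' W - (U t \<odot> A' + (- W) \<odot> A)) (at t)"
    by (rule has_vector_derivative_transform_within_open[where S = "{0<..}"])
       (use t in \<open>auto simp: grad_G_orthonormal flow_orthonormal\<close>)
  have "W \<bullet> (U t \<odot> A') = 0"
    using trace_gram_mult[of W "U t" A'] grad_G_tangent(2)[OF on]
    by (simp add: W_def trace_def matrix_matrix_mult_def)
  moreover have "hess_G g (U t) W W = W \<bullet> g' W - W \<bullet> (W \<odot> A)"
    by (simp add: hess_G_def trace_gram trace_gram_mult g'_def A_def)
  ultimately have H: "W \<bullet> (- g' W - (U t \<odot> A' + (- W) \<odot> A)) = - hess_G g (U t) W W"
    by (simp add: inner_diff_right inner_add_right bounded_bilinear.minus_left[OF bounded_bilinear_rmul])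
  have "((\<lambda>s. grad_G g (U s) \<bullet> grad_G g (U s)) has_vector_derivative
      W \<bullet> (- g' W - (U t \<odot> A' + (- W) \<odot> A)) + (- g' W - (U t \<odot> A' + (- W) \<odot> A)) \<bullet> W) (at t)"
    unfolding W_def
    by (intro bounded_bilinear.has_vector_derivative[OF bounded_bilinear_inner] dF[unfolded W_def])
  then have "((\<lambda>s. grad_G g (U s) \<bullet> grad_G g (U s)) has_vector_derivative - 2 * hess_G g (U t) W W) (at t)"
    using H by (simp add: inner_commute[of _ W])
  then show ?thesis
    by (simp add: has_real_derivative_iff_has_vector_derivative power2_norm_eq_inner W_def)
qed

section \<open>Exponential decay under the Hessian bound\<close>

theorem exponential_convergence:
  assumes \<delta>\<^sub>3: "\<delta>\<^sub>3 > 0" and \<sigma>: "\<sigma> > 0"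
    and diff: "\<And>X. gram X X = mat 1 \<Longrightarrow> gdist Us X \<le> \<delta>\<^sub>3 \<Longrightarrow> g differentiable (at X)"
    and hess: "\<And>X D. gram X X = mat 1 \<Longrightarrow> gdist Us X \<le> \<delta>\<^sub>3 \<Longrightarrow> gram D X = 0 \<Longrightarrow>
      \<sigma> * (norm D)\<^sup>2 \<le> hess_G g X D D"
  shows "\<exists>T>0. \<forall>t\<ge>T. norm (grad_G g (U t)) \<le> exp (- \<sigma> * (t - T)) \<and>
    E (U t) - E Us \<le> 1 / (2 * \<sigma>) * exp (- 2 * \<sigma> * (t - T))"
proof -
  define n where "n t = (norm (grad_G g (U t)))\<^sup>2" for t
  obtain T0 where T0: "T0 \<ge> 0" "\<And>t. t \<ge> T0 \<Longrightarrow> gdist Us (U t) < \<delta>\<^sub>3"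
    using gdist_flow_tendsto[OF \<delta>\<^sub>3] by blast
  \<comment> \<open>\<open>T0\<close> may be 0, whereas the flow equation needs positive
    times.\<close>
  define T1 where "T1 = T0 + 1"
  have T1: "T1 > 0" using T0 by (simp add: T1_def)
  have n': "\<exists>h. DERIV n t :> - 2 * h \<and> \<sigma> * n t \<le> h" if "t \<ge> T1" for t
  proof (intro exI conjI)
    have t: "t > 0" "gdist Us (U t) \<le> \<delta>\<^sub>3" using that T1 T0(2)[of t] by (auto simp: T1_def)
    then have on: "gram (U t) (U t) = mat 1" by (intro flow_orthonormal) simp
    show "DERIV n t :> - 2 * hess_G g (U t) (grad_G g (U t)) (grad_G g (U t))"
      unfolding n_def[abs_def] by (rule norm_grad_along_flow[OF t(1) diff[OF on t(2)]])
    show "\<sigma> * n t \<le> hess_G g (U t) (grad_G g (U t)) (grad_G g (U t))"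
      unfolding n_def by (rule hess[OF on t(2) grad_G_tangent(2)[OF on]])
  qed
  \<comment> \<open>Gronwall in product form: \<open>n t * exp (2 * \<sigma> * t)\<close> is
    nonincreasing from \<open>T1\<close> on, and \<open>C\<close> is its value there.\<close>
  define C where "C = n T1 * exp (2 * \<sigma> * T1)"
  have nC: "n t * exp (2 * \<sigma> * t) \<le> C" if t: "t \<ge> T1" for t
    unfolding C_def
  proof (rule DERIV_nonpos_imp_nonincreasing[OF t, of "\<lambda>t. n t * exp (2 * \<sigma> * t)"])
    fix x assume "T1 \<le> x"
    then obtain h where h: "DERIV n x :> - 2 * h" "\<sigma> * n x \<le> h" using n' by blast
    show "\<exists>y. DERIV (\<lambda>t. n t * exp (2 * \<sigma> * t)) x :> y \<and> y \<le> 0"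
    proof (intro exI conjI)
      show "DERIV (\<lambda>t. n t * exp (2 * \<sigma> * t)) x :> 2 * (\<sigma> * n x - h) * exp (2 * \<sigma> * x)"
        using h(1) by (auto intro!: derivative_eq_intros simp: algebra_simps)
      show "2 * (\<sigma> * n x - h) * exp (2 * \<sigma> * x) \<le> 0"
        using h(2) by (intro mult_nonpos_nonneg[of "2 * (\<sigma> * n x - h)"]) auto
    qed
  qed
  \<comment> \<open>Shifting time absorbs the constant: \<open>2 * \<sigma> * T\<close> is at least
    \<open>C\<close>, so its exponential dominates \<open>exp C\<close>, hence
    \<open>C\<close>.\<close>
  define T where "T = max T1 (C / (2 * \<sigma>))"
  have "C \<le> exp C" using exp_ge_add_one_self[of C] by linarith
  also have "\<dots> \<le> exp (2 * \<sigma> * T)" using \<sigma> by (simp add: T_def max_def field_simps)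
  finally have CT: "C \<le> exp (2 * \<sigma> * T)" .
  have nT: "n t \<le> exp (- 2 * \<sigma> * (t - T))" if "t \<ge> T" for t
  proof -
    have "n t * exp (2 * \<sigma> * t) \<le> exp (2 * \<sigma> * T)"
      using nC[of t] CT that by (simp add: T_def)
    then have "n t \<le> exp (2 * \<sigma> * T) / exp (2 * \<sigma> * t)" by (simp add: field_simps)
    then show ?thesis by (simp add: exp_diff[symmetric] algebra_simps)
  qed
  \<comment> \<open>The monotone quantity \<open>E (U t) - n t / (2 * \<sigma>)\<close> is compared
    with its value at a late time \<open>s\<close>, where the energy is below
    \<open>E Us + e\<close> and \<open>n s\<close> is nonnegative.\<close>
  have En: "E (U t) - E Us \<le> 1 / (2 * \<sigma>) * n t" if t: "t \<ge> T1" for t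
  proof (rule field_le_epsilon)
    fix e :: real assume "0 < e"
    then obtain S where S: "\<And>s. s \<ge> S \<Longrightarrow> E (U s) < E Us + e" using energy_tendsto by blast
    define s where "s = max S t"
    have "E (U t) - 1 / (2 * \<sigma>) * n t \<le> E (U s) - 1 / (2 * \<sigma>) * n s"
    proof (rule DERIV_nonneg_imp_nondecreasing[of t s "\<lambda>t. E (U t) - 1 / (2 * \<sigma>) * n t"])
      fix x assume "t \<le> x"
      then have x: "x \<ge> T1" "x > 0" using t T1 by auto
      then obtain h where h: "DERIV n x :> - 2 * h" "\<sigma> * n x \<le> h" using n' by blast
      show "\<exists>y. DERIV (\<lambda>t. E (U t) - 1 / (2 * \<sigma>) * n t) x :> y \<and> 0 \<le> y"
      proof (intro exI conjI)
        show "DERIV (\<lambda>t. E (U t) - 1 / (2 * \<sigma>) * n t) x :> - n x - 1 / (2 * \<sigma>) * (- 2 * h)"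
          using DERIV_diff[OF energy_along_flow[OF x(2)] DERIV_cmult[OF h(1), of "1 / (2 * \<sigma>)"]]
          by (simp add: n_def)
        show "0 \<le> - n x - 1 / (2 * \<sigma>) * (- 2 * h)" using h(2) \<sigma> by (simp add: field_simps)
      qed
    qed (simp add: s_def)
    moreover have "0 \<le> 1 / (2 * \<sigma>) * n s" using \<sigma> by (simp add: n_def)
    ultimately show "E (U t) - E Us \<le> 1 / (2 * \<sigma>) * n t + e"
      using S[of s] by (simp add: s_def)
  qed
  show ?thesis
  proof (intro exI conjI allI impI)
    show "T > 0" using T1 by (simp add: T_def)
    fix t assume t: "t \<ge> T"
    have "(norm (grad_G g (U t)))\<^sup>2 \<le> (exp (- \<sigma> * (t - T)))\<^sup>2"
      using nT[OF t] by (simp add: n_def power2_eq_square mult_exp_exp algebra_simps)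
    then show "norm (grad_G g (U t)) \<le> exp (- \<sigma> * (t - T))"
      by (rule power2_le_imp_le) simp
    have "E (U t) - E Us \<le> 1 / (2 * \<sigma>) * n t" using t by (intro En) (simp add: T_def)
    also have "\<dots> \<le> 1 / (2 * \<sigma>) * exp (- 2 * \<sigma> * (t - T))"
      using nT[OF t] \<sigma> by (intro mult_left_mono) auto
    finally show "E (U t) - E Us \<le> 1 / (2 * \<sigma>) * exp (- 2 * \<sigma> * (t - T))" .
  qed
qed

end

section \<open>Application to the Kohn-Sham energy\<close>

theorem theorem3p5:
  fixes \<iota> :: "'v::euclidean_space \<Rightarrow> real^3 \<Rightarrow> real"
    and Vext :: "real^3 \<Rightarrow> real"
    and exc vxc :: "(real^3 \<Rightarrow> real) \<Rightarrow> real^3 \<Rightarrow> real"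
    and Ustar U0 :: "'v^'n::finite"
    and U :: "real \<Rightarrow> 'v^'n"
    and \<delta>\<^sub>1 \<delta>\<^sub>2 \<delta>\<^sub>3 \<sigma> E\<^sub>0 E\<^sub>1 :: real
    and E :: "'v^'n \<Rightarrow> real"
    and gradE :: "'v^'n \<Rightarrow> 'v^'n"
  assumes E_def: "E = energy \<iota> Vext exc"
    and gradE_def: "gradE = grad_E \<iota> Vext vxc"
    and space: "H1_subspace \<iota>"
    and finite_energy: "energy_integrals_finite TYPE('n) Vext exc"
    and bounded_below: "\<exists>m. \<forall>u \<in> (stiefel_H1 :: ('n \<Rightarrow> real^3 \<Rightarrow> real) set). m \<le> ks_energy Vext exc u"
    and xc: "xc_differentiable TYPE('n) \<iota> exc vxc"
    and delta1: "\<delta>\<^sub>1 > 0"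
    and Ustar: "Ustar \<in> stiefel \<iota>"
    and local_min: "local_minimizer \<iota> E Ustar"
    and crit: "critical_point \<iota> gradE Ustar"
    and unique_crit: "\<And>X. critical_point \<iota> gradE X \<Longrightarrow> gclass X \<in> gball \<iota> Ustar \<delta>\<^sub>1 \<Longrightarrow> gclass X = gclass Ustar"
    and grad_continuous: "continuous_on (cball Ustar \<delta>\<^sub>1) gradE"
    and delta2: "0 < \<delta>\<^sub>2" "\<delta>\<^sub>2 \<le> \<delta>\<^sub>1"
    and E0: "is_minimum {E X |X. gclass X \<in> gclosure \<iota> (gball \<iota> Ustar \<delta>\<^sub>1 - gball \<iota> Ustar \<delta>\<^sub>2)} E\<^sub>0"
    and E1: "E\<^sub>1 = (E\<^sub>0 + E Ustar) / 2"
    and U0: "U0 \<in> stiefel \<iota>"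
    and flow_init: "U 0 = U0"
    and flow_cont: "continuous_on {0..} U"
    and flow: "\<And>t. t > 0 \<Longrightarrow> (U has_vector_derivative - grad_G gradE (U t)) (at t)"
    and U0_near: "gclass U0 \<in> gball \<iota> Ustar \<delta>\<^sub>2"
    and U0_above: "E Ustar \<le> E U0"
    and U0_level: "E U0 \<le> E\<^sub>1"
    and delta3: "0 < \<delta>\<^sub>3" "\<delta>\<^sub>3 \<le> \<delta>\<^sub>1"
    and sigma: "\<sigma> > 0"
    and twice_diff: "\<And>X. gclass X \<in> gball \<iota> Ustar \<delta>\<^sub>3 \<Longrightarrow> gradE differentiable (at X)"
    and hess: "\<And>X D. gclass X \<in> gball \<iota> Ustar \<delta>\<^sub>3 \<Longrightarrow> D \<in> tangent X \<Longrightarrow>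
                  hess_G gradE X D D \<ge> \<sigma> * (norm D)\<^sup>2"
  shows "\<exists>T>0. \<forall>t\<ge>T.
           norm (grad_G gradE (U t)) \<le> exp (- \<sigma> * (t - T)) \<and>
           E (U t) - E Ustar \<le> 1 / (2 * \<sigma>) * exp (- 2 * \<sigma> * (t - T))"
proof -
  interpret ks: kohn_sham \<iota> Vext exc vxc "TYPE('n)"
    using space finite_energy xc by unfold_locales
  have st: "X \<in> stiefel \<iota> \<longleftrightarrow> gram X X = mat 1" for X :: "'v^'n"
    by (rule ks.stiefel_iff)
  note ball = gclass_in_gball_iff[OF st]
  let ?A = "gball \<iota> Ustar \<delta>\<^sub>1 - gball \<iota> Ustar \<delta>\<^sub>2"
  \<comment> \<open>For equal radii the annulus and its closure are empty, and an empty set has no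
    minimum.\<close>
  have "\<delta>\<^sub>2 \<noteq> \<delta>\<^sub>1"
  proof
    assume "\<delta>\<^sub>2 = \<delta>\<^sub>1"
    then have "gclosure \<iota> ?A = {}" by (auto simp: gclosure_def intro: zero_less_one)
    then show False using E0 by (simp add: is_minimum_def)
  qed
  then have d: "\<delta>\<^sub>2 < \<delta>\<^sub>1" using delta2 by simp
  interpret fl: grassmann_flow E gradE Ustar \<delta>\<^sub>1 \<delta>\<^sub>2 E\<^sub>0 U
  proof unfold_locales
    show "(E has_derivative (\<lambda>W. gradE X \<bullet> W)) (at X)" for X
      unfolding E_def gradE_def by (rule ks.energy_has_derivative)
    show "transpose (gram X (gradE X)) = gram X (gradE X)" for X
      unfolding gradE_def by (rule ks.gram_grad_E_symmetric)
    show "E (X \<odot> P) = E X" "gradE (X \<odot> P) = gradE X \<odot> P" if "orthogonal_matrix P" for P X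
      unfolding E_def gradE_def using that by (rule ks.energy_rmul, rule ks.grad_E_rmul)
    show "gram Ustar Ustar = mat 1" using Ustar st by blast
    show "\<exists>P. orthogonal_matrix P \<and> X = Ustar \<odot> P"
      if "gram X X = mat 1" "gdist Ustar X \<le> \<delta>\<^sub>1" "grad_G gradE X = 0" for X
    proof -
      have "gclass X = gclass Ustar"
        using that by (intro unique_crit) (simp_all add: critical_point_def st ball)
      then show ?thesis by (metis gclass_eqE)
    qed
    show "E\<^sub>0 \<le> E X" if X: "gram X X = mat 1" "\<delta>\<^sub>2 < gdist Ustar X" "gdist Ustar X \<le> \<delta>\<^sub>1" for X
    proof -
      have "gclass X \<in> ?A" using X by (simp add: ball)
      \<comment> \<open>A point of the annulus lies in its closure by serving as its own
        approximant, which requires distance 0 to itself.\<close>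
      moreover have "gdist X X = 0"
        using gdist_self_rmul[OF orthogonal_matrix_id, of X] by (simp add: rmul_mat_1)
      ultimately have "gclass X \<in> gclosure \<iota> ?A"
        using X(1) st unfolding gclosure_def by force
      then show ?thesis using E0 unfolding is_minimum_def by blast
    qed
    show "gram (U 0) (U 0) = mat 1" "gdist Ustar (U 0) \<le> \<delta>\<^sub>2"
      using U0_near by (simp_all add: flow_init ball)
  qed (use grad_continuous delta2 d U0_above U0_level E1 flow_init flow_cont flow in simp_all)
  show ?thesis
    by (rule fl.exponential_convergence[OF delta3(1) sigma])
       (use twice_diff hess in \<open>simp_all add: ball tangent_def\<close>)
qed

end
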